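(* Let $G$ be a locally compact group with identity $e_G$ and a fixed left Haar measure $\mu$. Let $\{F_\theta\}_{\theta\in\Theta}$ be any approximate identity of $L^1(G)$ and $\{A_1,\dots,A_k\}$ any local partition of $G$ (at $e_G$). If $f\in L^\infty(G)$ and $x\in G$ are such that the limit $f(x,A_j):=\lim_{y\to e_G,\ y\in A_j}f(y^{-1}x)$ exists for every $1\le j\le k$, then there exists a subnet $\Theta_1$ of $\Theta$ such that for every $1\le j\le k$ the limit $\lambda_j(\Theta_1):=\lim_{\theta\in\Theta_1}\int_{A_j}F_\theta(y)\,d\mu(y)$ exists, and $$\lim_{\theta\in\Theta_1}F_\theta*f(x)=\sum_{j=1}^k\lambda_j(\Theta_1)f(x,A_j).$$ Moreover, if $\lim_{\theta\in\Theta_1}\sup_{y\in G\setminus\mathcal{N}}|F_\theta(y)|=0$ for every neighborhood $\mathcal{N}$ of $e_G$, then for every $f$ in $L^1(G)$ (or in $L^\infty(G)$) and every $x\in G$ such that $f(x,A_j)$ exists for every $1\le j\le k$, $$\lim_{\theta\in\Theta_1}F_\theta*f(x)=\sum_{j=1}^k\lambda_j(\Theta_1)f(x,A_j).$$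
   Context: $L^1(G)$ and $L^\infty(G)$ are the spaces of integrable, respectively essentially bounded, (complex-valued) functions on $G$ with respect to $\mu$; $f$ is a pointwise-defined function. Convolution: $F*f(x)=\int_G F(y)f(y^{-1}x)\,d\mu(y)$. Approximate identity of $L^1(G)$: a family (net) $\{F_\theta\}_{\theta\in\Theta}$ in $L^1(G)$ such that (i) there is a constant $C$ with $\|F_\theta\|_{L^1(G)}\le C$ for all $\theta$; (ii) $\int_G F_\theta\,d\mu=1$ for all $\theta$; (iii) $\lim_\theta\int_{G\setminus\mathcal{N}}|F_\theta|\,d\mu=0$ for every neighborhood $\mathcal{N}$ of $e_G$. Local partition of $G$ (at $e_G$): a finite collection $\{A_1,\dots,A_k\}$ of Borel subsets of $G$ such that (i) $A_i\cap A_j=\emptyset$ for $i\ne j$; (ii) $\mu(G\setminus\bigcup_{i=1}^kA_i)=0$; (iii) $A_j\cap\mathcal{N}\neq\emptyset$ for every $j$ and every neighborhood $\mathcal{N}$ of $e_G$. The statement $\lim_{y\to e_G,\,y\in A_j}f(y^{-1}x)=L$ means: for every $\varepsilon>0$ there is a neighborhood $\mathcal{N}$ of $e_G$ such that $|f(y^{-1}x)-L|<\varepsilon$ for all $y\in\mathcal{N}\cap A_j$.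
   Formalization: In the "Moreover" part, for f in L^1(G) on a non-unimodular G, y ↦ f(y^{-1}) is additionally assumed to be integrable; without this the claim fails, e.g. on the ax+b group. Unimodular G and the L^∞(G) case are unchanged. *)

theory Defs
  imports "HOL-Analysis.Analysis"
begin

text \<open>
  Groups are written additively, following the library class of topological groups
  (which is not assumed commutative): \<open>e\<^sub>G\<close> is \<open>0\<close>, \<open>x y\<close> is \<open>x + y\<close>, and
  \<open>y\<^sup>-\<^sup>1 x\<close> is \<open>- y + x\<close>.
\<close>

definition left_haar_measure :: "'g::topological_group_add measure \<Rightarrow> bool" where
  "left_haar_measure M \<longleftrightarrow>
     sets M = sets borel \<and>
     emeasure M UNIV \<noteq> 0 \<and>
     (\<forall>a. \<forall>B\<in>sets borel. emeasure M ((\<lambda>y. a + y) ` B) = emeasure M B) \<and>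
     (\<forall>K. compact K \<and> K \<in> sets borel \<longrightarrow> emeasure M K < \<infinity>) \<and>
     (\<forall>B\<in>sets borel. emeasure M B = (INF U\<in>{U. open U \<and> B \<subseteq> U}. emeasure M U)) \<and>
     (\<forall>U. open U \<longrightarrow>
        emeasure M U = (SUP K\<in>{K. compact K \<and> K \<in> sets borel \<and> K \<subseteq> U}. emeasure M K))"

definition unimodular :: "'g::topological_group_add measure \<Rightarrow> bool" where
  "unimodular M \<longleftrightarrow>
     (\<forall>a. \<forall>B\<in>sets borel. emeasure M ((\<lambda>y. y + a) ` B) = emeasure M B)"

definition L_infinity :: "'g measure \<Rightarrow> ('g \<Rightarrow> complex) \<Rightarrow> bool" where
  "L_infinity M f \<longleftrightarrow> f \<in> borel_measurable M \<and> (\<exists>C. AE y in M. norm (f y) \<le> C)"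

definition convolution ::
    "'g::topological_group_add measure \<Rightarrow> ('g \<Rightarrow> complex) \<Rightarrow> ('g \<Rightarrow> complex) \<Rightarrow> 'g \<Rightarrow> complex" where
  "convolution M F f x = (LINT y|M. F y * f (- y + x))"

text \<open>The library integral of a non-integrable function is \<open>0\<close>; the next predicate says that
  the integral defining the convolution at \<open>x\<close> really exists.\<close>

definition convolution_defined ::
    "'g::topological_group_add measure \<Rightarrow> ('g \<Rightarrow> complex) \<Rightarrow> ('g \<Rightarrow> complex) \<Rightarrow> 'g \<Rightarrow> bool" where
  "convolution_defined M F f x \<longleftrightarrow> integrable M (\<lambda>y. F y * f (- y + x))"

definition directed_set :: "'i set \<Rightarrow> ('i \<Rightarrow> 'i \<Rightarrow> bool) \<Rightarrow> bool" where
  "directed_set D le \<longleftrightarrow>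
     D \<noteq> {} \<and>
     (\<forall>a\<in>D. le a a) \<and>
     (\<forall>a\<in>D. \<forall>b\<in>D. \<forall>c\<in>D. le a b \<longrightarrow> le b c \<longrightarrow> le a c) \<and>
     (\<forall>a\<in>D. \<forall>b\<in>D. \<exists>c\<in>D. le a c \<and> le b c)"

text \<open>The filter of tails: \<open>(u \<longlongrightarrow> l) (net_filter D le)\<close> is convergence of the net \<open>u\<close>
  indexed by the directed set \<open>D\<close>.\<close>

definition net_filter :: "'i set \<Rightarrow> ('i \<Rightarrow> 'i \<Rightarrow> bool) \<Rightarrow> 'i filter" where
  "net_filter D le = (INF a\<in>D. principal {b\<in>D. le a b})"

lemma eventually_net_filter:
  assumes "directed_set D le"
  shows "eventually P (net_filter D le) \<longleftrightarrow> (\<exists>a\<in>D. \<forall>b\<in>D. le a b \<longrightarrow> P b)"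
proof -
  have "eventually P (net_filter D le) \<longleftrightarrow>
        (\<exists>a\<in>D. eventually P (principal {b\<in>D. le a b}))"
    unfolding net_filter_def
  proof (rule eventually_INF_base)
    show "D \<noteq> {}" using assms by (simp add: directed_set_def)
  next
    fix a b assume ab: "a \<in> D" "b \<in> D"
    then obtain c where c: "c \<in> D" "le a c" "le b c"
      using assms unfolding directed_set_def by blast
    have "{d\<in>D. le c d} \<subseteq> {d\<in>D. le a d} \<inter> {d\<in>D. le b d}"
      using assms ab c unfolding directed_set_def by blast
    then show "\<exists>x\<in>D. principal {b\<in>D. le x b}
        \<le> inf (principal {b\<in>D. le a b}) (principal {d\<in>D. le b d})"
      using c(1) by auto
  qed
  then show ?thesis by (auto simp: eventually_principal)
qed

text \<open>Subnets in the sense of Willard: \<open>(E, le')\<close> is a directed set and \<open>\<phi>\<close> is an order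
  preserving map into \<open>(D, le)\<close> with cofinal image. Of the usual notions of subnet this is the
  most restrictive one; the subnet of a net \<open>F\<close> is \<open>\<lambda>\<eta>. F (\<phi> \<eta>)\<close>.\<close>

definition subnet ::
    "'i set \<Rightarrow> ('i \<Rightarrow> 'i \<Rightarrow> bool) \<Rightarrow> 'j set \<Rightarrow> ('j \<Rightarrow> 'j \<Rightarrow> bool) \<Rightarrow> ('j \<Rightarrow> 'i) \<Rightarrow> bool" where
  "subnet D le E le' \<phi> \<longleftrightarrow>
     directed_set E le' \<and>
     \<phi> ` E \<subseteq> D \<and>
     monotone_on E le' le \<phi> \<and>
     (\<forall>a\<in>D. \<exists>\<eta>\<in>E. le a (\<phi> \<eta>))"

text \<open>In the next two definitions, neighbourhoods of the identity may be taken open, since both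
  conditions only become harder to satisfy when the neighbourhood shrinks.\<close>

definition approximate_identity ::
    "'g::topological_group_add measure \<Rightarrow> 'i set \<Rightarrow> ('i \<Rightarrow> 'i \<Rightarrow> bool) \<Rightarrow>
     ('i \<Rightarrow> 'g \<Rightarrow> complex) \<Rightarrow> bool" where
  "approximate_identity M D le F \<longleftrightarrow>
     directed_set D le \<and>
     (\<forall>\<theta>\<in>D. integrable M (F \<theta>)) \<and>
     (\<exists>C. \<forall>\<theta>\<in>D. (LINT y|M. norm (F \<theta> y)) \<le> C) \<and>
     (\<forall>\<theta>\<in>D. (LINT y|M. F \<theta> y) = 1) \<and>
     (\<forall>N. open N \<and> 0 \<in> N \<longrightarrow>
        ((\<lambda>\<theta>. LINT y:-N|M. norm (F \<theta> y)) \<longlongrightarrow> 0) (net_filter D le))"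

definition local_partition ::
    "'g::topological_group_add measure \<Rightarrow> nat \<Rightarrow> (nat \<Rightarrow> 'g set) \<Rightarrow> bool" where
  "local_partition M k A \<longleftrightarrow>
     (\<forall>j\<in>{1..k}. A j \<in> sets borel) \<and>
     disjoint_family_on A {1..k} \<and>
     emeasure M (UNIV - (\<Union>j\<in>{1..k}. A j)) = 0 \<and>
     (\<forall>j\<in>{1..k}. \<forall>N. open N \<and> 0 \<in> N \<longrightarrow> A j \<inter> N \<noteq> {})"

text \<open>\<open>limit_along f x S L\<close> says that \<open>f (y\<^sup>-\<^sup>1 x)\<close> tends to \<open>L\<close> as \<open>y\<close> tends to the identity inside
  \<open>S\<close>. Unlike \<open>at 0 within S\<close>, the point \<open>y = 0\<close> is not excluded when it lies in \<open>S\<close>.\<close>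

definition limit_along ::
    "('g::topological_group_add \<Rightarrow> complex) \<Rightarrow> 'g \<Rightarrow> 'g set \<Rightarrow> complex \<Rightarrow> bool" where
  "limit_along f x S L \<longleftrightarrow> ((\<lambda>y. f (- y + x)) \<longlongrightarrow> L) (inf (nhds 0) (principal S))"

lemma limit_along_iff:
  "limit_along f x S L \<longleftrightarrow>
     (\<forall>\<epsilon>>0. \<exists>N. open N \<and> 0 \<in> N \<and> (\<forall>y\<in>N \<inter> S. norm (f (- y + x) - L) < \<epsilon>))"
  unfolding limit_along_def tendsto_iff eventually_inf_principal eventually_nhds dist_norm Ball_def Int_iff
  by (intro all_cong imp_cong ex_cong1 refl) blast

text \<open>The limit relation \<open>lim\<^sub>\<eta> F\<^sub>\<eta> * f (x) = l\<close> along a filter, the convolutions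
  being defined from some index on.\<close>

definition convolution_tendsto ::
    "'g::topological_group_add measure \<Rightarrow> ('i \<Rightarrow> 'g \<Rightarrow> complex) \<Rightarrow> ('g \<Rightarrow> complex) \<Rightarrow> 'g \<Rightarrow>
     complex \<Rightarrow> 'i filter \<Rightarrow> bool" where
  "convolution_tendsto M F f x l \<F> \<longleftrightarrow>
     (\<forall>\<^sub>F \<eta> in \<F>. convolution_defined M (F \<eta>) f x) \<and>
     ((\<lambda>\<eta>. convolution M (F \<eta>) f x) \<longlongrightarrow> l) \<F>"

text \<open>
  The class of integrable functions for which the second convergence assertion is made.
  For a left Haar measure, \<open>y \<mapsto> f (y\<^sup>-\<^sup>1 x)\<close> need not be integrable when \<open>f\<close> is, and the
  assertion fails for some integrable \<open>f\<close> on the affine group of the line. On a unimodular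
  group the second conjunct holds trivially and the class is all of \<open>L\<^sup>1\<close>; on other groups
  \<open>y \<mapsto> f (y\<^sup>-\<^sup>1)\<close> is required to be integrable as well.
\<close>

definition L_one_admissible ::
    "'g::topological_group_add measure \<Rightarrow> ('g \<Rightarrow> complex) \<Rightarrow> bool" where
  "L_one_admissible M f \<longleftrightarrow>
     integrable M f \<and> (unimodular M \<or> integrable M (\<lambda>y. f (- y)))"

end

theory Submission
  imports Defs
begin

text \<open>
  Choose a subnet along which the bounded complex numbers \<open>\<integral>\<^bsub>A\<^sub>j\<^esub> F\<^sub>\<theta>\<close> converge for all \<open>j\<close>, and
  compare \<open>y \<mapsto> g (y\<^sup>-\<^sup>1 z)\<close> with the step function \<open>s = \<Sum>\<^sub>j K\<^sub>j 1\<^bsub>A\<^sub>j\<^esub>\<close>: the integral of \<open>F\<^sub>\<theta> s\<close> converges to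
  \<open>\<Sum>\<^sub>j \<lambda>\<^sub>j K\<^sub>j\<close>, and \<open>F\<^sub>\<theta> (g - s)\<close> is at most \<open>\<epsilon> |F\<^sub>\<theta>|\<close> near the identity, so that only the integrals
  of \<open>|F\<^sub>\<theta>|\<close> and \<open>|F\<^sub>\<theta> g|\<close> away from the identity have to vanish.

  These tails involve \<open>g\<close> through \<open>y\<^sup>-\<^sup>1\<close>, which left invariance does not control. It suffices
  that inversion maps null sets to locally null sets and, on a unimodular group, that it distorts
  the measure by at most a constant factor. Both follow from one covering estimate, without the
  modular function or uniqueness of Haar measure.
\<close>

section \<open>Inversion and left Haar measures\<close>

text \<open>Each new set gives up what the earlier ones already cover. Finite covers by translates
  become partitions in this way, so that sums of measures over the pieces are exact.\<close>

lemma finite_cover_disjoint_refinement: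
  assumes "finite T" "\<And>t. t \<in> T \<Longrightarrow> B t \<in> sets M"
  obtains Q where "\<And>t. t \<in> T \<Longrightarrow> Q t \<in> sets M" "\<And>t. t \<in> T \<Longrightarrow> Q t \<subseteq> B t"
    "disjoint_family_on Q T" "(\<Union>t\<in>T. Q t) = (\<Union>t\<in>T. B t)"
proof -
  have "\<exists>Q. (\<forall>t\<in>T. Q t \<in> sets M) \<and> (\<forall>t\<in>T. Q t \<subseteq> B t) \<and>
    disjoint_family_on Q T \<and> (\<Union>t\<in>T. Q t) = (\<Union>t\<in>T. B t)"
    using assms
  proof (induction T rule: finite_induct)
    case empty
    then show ?case by (simp add: disjoint_family_on_def)
  next
    case (insert t T)
    have "\<exists>Q. (\<forall>t\<in>T. Q t \<in> sets M) \<and> (\<forall>t\<in>T. Q t \<subseteq> B t) \<and>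
      disjoint_family_on Q T \<and> (\<Union>t\<in>T. Q t) = (\<Union>t\<in>T. B t)"
      using insert.prems by (intro insert.IH) simp
    then obtain Q where Q: "\<forall>t\<in>T. Q t \<in> sets M" "\<forall>t\<in>T. Q t \<subseteq> B t"
      "disjoint_family_on Q T" "(\<Union>t\<in>T. Q t) = (\<Union>t\<in>T. B t)" by (elim exE conjE)
    define Q' where "Q' = Q(t := B t - (\<Union>t\<in>T. B t))"
    have Q't: "Q' t = B t - (\<Union>t\<in>T. B t)" by (simp add: Q'_def)
    have Q'T: "Q' s = Q s" if "s \<in> T" for s
      using that insert.hyps(2) by (simp add: Q'_def fun_upd_def) blast
    have un: "(\<Union>s\<in>T. Q' s) = (\<Union>t\<in>T. B t)"
      using Q'T Q(4) by (simp cong: SUP_cong)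
    have "B t - (\<Union>t\<in>T. B t) \<in> sets M"
      using insert.hyps(1) insert.prems by (intro sets.Diff sets.finite_UN) simp_all
    then have "\<forall>s\<in>insert t T. Q' s \<in> sets M"
      using Q(1) Q'T Q't by simp
    moreover have "\<forall>s\<in>insert t T. Q' s \<subseteq> B s"
      using Q(2) Q'T Q't by simp
    moreover have "disjoint_family_on Q' T"
      using Q(3) Q'T by (simp add: disjoint_family_on_def)
    then have "disjoint_family_on Q' (insert t T)"
      using insert.hyps(2) un Q't by (simp add: disjoint_family_on_insert Diff_disjoint Int_commute)
    moreover have "(\<Union>s\<in>insert t T. Q' s) = (\<Union>s\<in>insert t T. B s)"
      using un Q't by (simp add: Un_Diff_cancel2)
    ultimately show ?case by (intro exI[of _ Q'] conjI)
  qed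
  then obtain Q where "\<forall>t\<in>T. Q t \<in> sets M" "\<forall>t\<in>T. Q t \<subseteq> B t"
    "disjoint_family_on Q T" "(\<Union>t\<in>T. Q t) = (\<Union>t\<in>T. B t)" by (elim exE conjE)
  then show ?thesis by (intro that[of Q]) simp_all
qed

section \<open>Translations, inversion and compactness in a topological group\<close>

lemma open_translation_left:
  fixes U :: "'g::topological_group_add set"
  assumes "open U" shows "open ((+) a ` U)"
proof -
  have "(+) a ` U = (\<lambda>y. - a + y) -` U"
    by (force simp: image_iff add.assoc[symmetric])
  then show ?thesis using assms by (simp add: open_vimage continuous_intros)
qed

lemma open_translation_right:
  fixes U :: "'g::topological_group_add set"
  assumes "open U" shows "open ((\<lambda>y. y + a) ` U)"
proof -
  have "(\<lambda>y. y + a) ` U = (\<lambda>y. y - a) -` U"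
    by (force simp: image_iff)
  moreover have "continuous_on UNIV (\<lambda>y::'g. y - a)"
    by (intro continuous_intros)
  ultimately show ?thesis using assms by (simp add: open_vimage)
qed

lemma open_uminus_image:
  fixes U :: "'g::topological_group_add set"
  assumes "open U" shows "open (uminus ` U)"
proof -
  have "uminus ` U = uminus -` U"
    by (force simp: image_iff)
  moreover have "continuous_on UNIV (uminus :: 'g \<Rightarrow> 'g)"
    by (intro continuous_intros)
  ultimately show ?thesis using assms by (simp add: open_vimage)
qed

lemma compact_uminus_image:
  fixes K :: "'g::{topological_group_add} set"
  assumes "compact K" shows "compact (uminus ` K)"
  using assms by (intro compact_continuous_image continuous_intros)

lemma compact_group_sums:
  fixes S T :: "'g::{topological_group_add} set"
  assumes "compact S" "compact T"
  shows "compact ((\<lambda>(a, b). a + b) ` (S \<times> T))"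
  using assms by (intro compact_continuous_image compact_Times)
    (auto simp: split_beta intro!: continuous_intros)

lemma borel_translation:
  fixes B :: "'g::topological_group_add set"
  assumes "B \<in> sets borel" shows "(+) a ` B \<in> sets borel"
proof -
  have "(+) a ` B = (\<lambda>y. - a + y) -` B"
    by (force simp: image_iff add.assoc[symmetric])
  moreover have "(\<lambda>y::'g. - a + y) \<in> borel_measurable borel"
    by (intro borel_measurable_continuous_onI continuous_intros)
  ultimately show ?thesis using assms by (auto dest: measurable_sets[of _ borel borel B])
qed

lemma borel_uminus_image:
  fixes B :: "'g::topological_group_add set"
  assumes "B \<in> sets borel" shows "uminus ` B \<in> sets borel"
proof -
  have "uminus ` B = uminus -` B"
    by (force simp: image_iff)
  moreover have "(uminus :: 'g \<Rightarrow> 'g) \<in> borel_measurable borel"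
    by (intro borel_measurable_continuous_onI continuous_intros)
  ultimately show ?thesis using assms by (auto dest: measurable_sets[of _ borel borel B])
qed

text \<open>The preimage of \<open>U\<close> under addition is open and contains
  \<open>{0} \<times> P\<close>, so the tube lemma yields a whole strip \<open>V \<times> P\<close>
  inside it.\<close>

lemma compact_add_subset_open:
  fixes P U :: "'g::topological_group_add set"
  assumes "compact P" "open U" "P \<subseteq> U"
  obtains V where "open V" "0 \<in> V" "\<And>v p. v \<in> V \<Longrightarrow> p \<in> P \<Longrightarrow> v + p \<in> U"
proof -
  let ?W = "(\<lambda>p. fst p + snd p) -` U"
  have "continuous_on UNIV (\<lambda>p::'g\<times>'g. fst p + snd p)"
    by (intro continuous_intros)
  then have "open ?W"
    using \<open>open U\<close> by (simp add: open_vimage)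
  moreover have "{0} \<times> P \<subseteq> ?W" using assms(3) by auto
  ultimately have "\<exists>V. 0 \<in> V \<and> open V \<and> V \<times> P \<subseteq> ?W"
    by (rule Elementary_Topology.tube_lemma[OF assms(1)])
  then obtain V where V: "0 \<in> V" "open V" "V \<times> P \<subseteq> ?W" by (elim exE conjE)
  have "v + p \<in> U" if "v \<in> V" "p \<in> P" for v p
    using subsetD[OF V(3), of "(v, p)"] that by simp
  then show ?thesis by (rule that[OF V(2,1)])
qed

lemma compact_finite_translates:
  fixes K V :: "'g::topological_group_add set"
  assumes "compact K" "open V" "0 \<in> V"
  obtains T where "finite T" "K \<subseteq> (\<Union>t\<in>T. (+) t ` V)"
proof -
  have "K \<subseteq> (\<Union>t\<in>K. (+) t ` V)"
    using assms(3) by force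
  then obtain T where "T \<subseteq> K" "finite T" "K \<subseteq> (\<Union>t\<in>T. (+) t ` V)"
    using compactE_image[OF assms(1), of K "\<lambda>t. (+) t ` V"] open_translation_left[OF assms(2)]
    by blast
  then show ?thesis using that by blast
qed

lemma emeasure_mono_finite:
  "A \<subseteq> B \<Longrightarrow> B \<in> sets M \<Longrightarrow> emeasure M B < \<infinity> \<Longrightarrow> emeasure M A < \<infinity>"
  by (rule le_less_trans[OF emeasure_mono])

section \<open>Consequences of left invariance and regularity\<close>

context
  fixes M :: "'g::{topological_group_add, t2_space} measure"
  assumes haar: "left_haar_measure M"
begin

lemma sets_haar: "sets M = sets borel"
  using haar by (simp add: left_haar_measure_def)

lemma space_haar: "space M = UNIV"
  using sets_eq_imp_space_eq[OF sets_haar] by simp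

lemma emeasure_haar_translate:
  "B \<in> sets borel \<Longrightarrow> emeasure M ((+) a ` B) = emeasure M B"
  using haar unfolding left_haar_measure_def by (elim conjE) (drule spec, rule bspec)

lemma emeasure_haar_compact: "compact K \<Longrightarrow> emeasure M K < \<infinity>"
  using haar borel_compact[of K] unfolding left_haar_measure_def by (elim conjE) (drule spec, erule mp, simp)

lemma emeasure_haar_outer:
  "B \<in> sets borel \<Longrightarrow> emeasure M B = (INF U\<in>{U. open U \<and> B \<subseteq> U}. emeasure M U)"
  using haar unfolding left_haar_measure_def by (elim conjE) (rule bspec)

lemma emeasure_haar_inner:
  assumes "open U"
  shows "emeasure M U = (SUP K\<in>{K. compact K \<and> K \<subseteq> U}. emeasure M K)"
proof -
  have "{K. compact K \<and> K \<in> sets borel \<and> K \<subseteq> U} = {K. compact K \<and> K \<subseteq> U}"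
    using borel_compact by auto
  moreover have "emeasure M U = (SUP K\<in>{K. compact K \<and> K \<in> sets borel \<and> K \<subseteq> U}. emeasure M K)"
    using haar assms unfolding left_haar_measure_def by (elim conjE) (drule spec, erule (1) mp)
  ultimately show ?thesis by (simp only:)
qed

lemma haar_outer_approx:
  assumes "B \<in> sets borel" "emeasure M B < \<infinity>" "e > (0::real)"
  obtains U where "open U" "B \<subseteq> U" "emeasure M U < emeasure M B + e"
proof -
  have "\<exists>U\<in>{U. open U \<and> B \<subseteq> U}. emeasure M U < emeasure M B + ennreal e"
    using assms by (intro INF_approx_ennreal emeasure_haar_outer) auto
  then show ?thesis using that by blast
qed

text \<open>Outer regularity carries a linear bound from open supersets to the Borel set itself;
  finiteness of \<open>c\<close> keeps the approximation error \<open>c * e\<close> under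
  control.\<close>

lemma le_mult_emeasure_outer:
  assumes B: "B \<in> sets borel" and c: "c < \<infinity>"
    and le: "\<And>U. open U \<Longrightarrow> B \<subseteq> U \<Longrightarrow> a \<le> c * emeasure M U"
  shows "a \<le> c * emeasure M B"
proof (cases "emeasure M B = \<infinity>")
  case True
  \<comment> \<open>A product of \<open>\<infinity>\<close> with a nonzero \<open>c\<close> bounds
    everything; for \<open>c = 0\<close> the hypothesis at \<open>UNIV\<close> already gives
    \<open>a = 0\<close>.\<close>
  then show ?thesis using le[of UNIV] by (cases "c = 0") (auto simp: ennreal_mult_top)
next
  case False
  obtain r where r: "c = ennreal r" "r \<ge> 0" using c by (cases c) auto
  show ?thesis
  proof (rule ennreal_le_epsilon)
    fix e :: real assume e: "e > 0"
    \<comment> \<open>The denominator is \<open>r + 1\<close> and not \<open>r\<close>, since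
      \<open>r\<close> may vanish.\<close>
    then have "e / (r + 1) > 0" using r by simp
    then obtain U where U: "open U" "B \<subseteq> U" "emeasure M U < emeasure M B + ennreal (e / (r + 1))"
      using haar_outer_approx[OF B] False by (metis infinity_ennreal_def less_top)
    have "a \<le> c * (emeasure M B + ennreal (e / (r + 1)))"
      using le[OF U(1,2)] U(3) by (meson mult_left_mono order.trans less_imp_le zero_le)
    also have "\<dots> = c * emeasure M B + ennreal (r * (e / (r + 1)))"
      using r e by (simp only: distrib_left) (simp flip: ennreal_mult)
    also have "\<dots> \<le> c * emeasure M B + ennreal e"
      using r e by (intro add_left_mono ennreal_leI) (simp add: field_simps)
    finally show "a \<le> c * emeasure M B + ennreal e" .
  qed
qed

text \<open>A null nonempty open set has a null translate around \<open>0\<close>. Finitely many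
  translates of it cover any compact set, so all compact sets are null, and inner regularity makes
  the whole group null.\<close>

lemma haar_open_pos:
  assumes "open U" "U \<noteq> {}"
  shows "emeasure M U > 0"
proof (rule ccontr)
  assume "\<not> emeasure M U > 0"
  then have U0: "emeasure M U = 0" by simp
  obtain u where u: "u \<in> U" using assms(2) by auto
  define V where "V = (+) (- u) ` U"
  have V: "open V" "0 \<in> V" "emeasure M V = 0"
    using u assms(1) U0 by (auto simp: V_def open_translation_left emeasure_haar_translate
      image_iff intro!: bexI[of _ u])
  have "emeasure M K = 0" if "compact K" for K
  proof -
    obtain T where T: "finite T" "K \<subseteq> (\<Union>t\<in>T. (+) t ` V)"
      using compact_finite_translates[OF \<open>compact K\<close> V(1,2)] .
    have "(\<Union>t\<in>T. (+) t ` V) \<in> null_sets M"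
      using T(1) V by (intro null_sets.finite_UN)
        (auto simp: null_sets_def sets_haar emeasure_haar_translate open_translation_left)
    then show ?thesis
      using T(2) borel_compact[OF that] by (metis null_setsD1 null_sets_subset sets_haar)
  qed
  then have "emeasure M UNIV = 0"
    by (subst emeasure_haar_inner) (auto simp: bot_ennreal[symmetric])
  then show False using haar by (simp add: left_haar_measure_def)
qed

text \<open>Double counting of the pairs \<open>(y, p)\<close> with \<open>y + p\<close> in \<open>E\<close>. Borel sets of the product
  group need not be measurable for the product measure, so Fubini's theorem is replaced by a
  finite partition of \<open>E\<close> into pieces \<open>Q\<^sub>q \<subseteq> q + V\<close> with \<open>V - P \<subseteq> U\<close>, where \<open>U\<close> is a
  neighbourhood of \<open>- P\<close>: if \<open>y + P\<close> meets \<open>Q\<^sub>q\<close> then \<open>y \<in> q + U\<close>.\<close>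

lemma emeasure_mult_le_emeasure_uminus_compact:
  assumes P: "compact P" and "open O'" and E: "compact E"
    and sub: "\<And>y p. y \<in> O' \<Longrightarrow> p \<in> P \<Longrightarrow> y + p \<in> E"
  shows "emeasure M P * emeasure M O' \<le> emeasure M E * emeasure M (uminus ` P)"
proof (rule le_mult_emeasure_outer)
  \<comment> \<open>The factor \<open>emeasure M E\<close> is finite, so outer regularity allows
    \<open>- P\<close> to be replaced by an open \<open>U\<close> around it.\<close>
  show "uminus ` P \<in> sets borel" using P by (intro borel_uminus_image borel_compact)
  show "emeasure M E < \<infinity>" using E by (rule emeasure_haar_compact)
  fix U assume U: "open U" "uminus ` P \<subseteq> U"
  obtain V where V: "open V" "0 \<in> V" "\<And>v p. v \<in> V \<Longrightarrow> p \<in> uminus ` P \<Longrightarrow> v + p \<in> U"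
    using compact_add_subset_open[OF compact_uminus_image[OF P] U] by metis
  obtain T where T: "finite T" "E \<subseteq> (\<Union>t\<in>T. (+) t ` V)"
    using compact_finite_translates[OF E V(1,2)] .
  obtain Q where Q: "\<And>t. t \<in> T \<Longrightarrow> Q t \<in> sets M" "\<And>t. t \<in> T \<Longrightarrow> Q t \<subseteq> E \<inter> (+) t ` V"
    "disjoint_family_on Q T" "(\<Union>t\<in>T. Q t) = (\<Union>t\<in>T. E \<inter> (+) t ` V)"
    by (rule finite_cover_disjoint_refinement[OF T(1), of "\<lambda>t. E \<inter> (+) t ` V" M])
      (use E V in \<open>auto simp: sets_haar borel_compact open_translation_left\<close>)
  have QE: "(\<Union>t\<in>T. Q t) = E" using Q(4) T(2) by auto
  have Ps: "(+) y ` P \<in> sets M" for y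
    using P by (simp add: sets_haar borel_compact borel_translation)
  have tU: "(+) t ` U \<in> sets M" for t
    using U by (simp add: sets_haar open_translation_left)
  have O's: "O' \<in> sets M" using \<open>open O'\<close> by (simp add: sets_haar)
  \<comment> \<open>For \<open>y\<close> in \<open>O'\<close> the translate \<open>y + P\<close>
    lies in \<open>E\<close> and has the measure of \<open>P\<close>. Cutting it along the
    \<open>Q t\<close> bounds that measure by those pieces which it meets.\<close>
  have pw: "emeasure M P * indicator O' y \<le> (\<Sum>t\<in>T. emeasure M (Q t) * indicator ((+) t ` U) y)" for y
  proof (cases "y \<in> O'")
    case True
    have "emeasure M P = emeasure M ((+) y ` P)"
      using P by (simp add: emeasure_haar_translate borel_compact)
    also have "(+) y ` P = (\<Union>t\<in>T. (+) y ` P \<inter> Q t)"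
      using sub[OF True] QE by auto
    also have "emeasure M \<dots> \<le> (\<Sum>t\<in>T. emeasure M ((+) y ` P \<inter> Q t))"
      using T(1) Q(1) Ps by (intro emeasure_subadditive_finite) auto
    also have "\<dots> \<le> (\<Sum>t\<in>T. emeasure M (Q t) * indicator ((+) t ` U) y)"
    proof (rule sum_mono)
      fix t assume t: "t \<in> T"
      show "emeasure M ((+) y ` P \<inter> Q t) \<le> emeasure M (Q t) * indicator ((+) t ` U) y"
      proof (cases "(+) y ` P \<inter> Q t = {}")
        case False
        then obtain p where p: "p \<in> P" "y + p \<in> Q t" by auto
        then obtain v where v: "v \<in> V" "y + p = t + v" using Q(2)[OF t] by auto
        then have "y = t + (v + - p)"
          by (metis add.assoc add_minus_cancel add.right_neutral right_minus)
        then have "y \<in> (+) t ` U" using V(3)[OF v(1)] p(1) by blast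
        then show ?thesis using Q(1)[OF t] by (auto intro!: emeasure_mono)
      qed simp
    qed
    finally show ?thesis using True by simp
  qed simp
  \<comment> \<open>Integrating the pointwise bound over \<open>y\<close> replaces each indicator of
    \<open>t + U\<close> by the measure of \<open>U\<close>, and the measures of the
    \<open>Q t\<close> add up to that of \<open>E\<close>.\<close>
  have "emeasure M P * emeasure M O' = (\<integral>\<^sup>+y. emeasure M P * indicator O' y \<partial>M)"
    using O's by (simp add: nn_integral_cmult_indicator)
  also have "\<dots> \<le> (\<integral>\<^sup>+y. (\<Sum>t\<in>T. emeasure M (Q t) * indicator ((+) t ` U) y) \<partial>M)"
    by (intro nn_integral_mono pw)
  also have "\<dots> = (\<Sum>t\<in>T. \<integral>\<^sup>+y. emeasure M (Q t) * indicator ((+) t ` U) y \<partial>M)"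
    using tU by (intro nn_integral_sum) auto
  also have "\<dots> = (\<Sum>t\<in>T. emeasure M (Q t) * emeasure M U)"
    using tU U by (intro sum.cong) (auto simp: nn_integral_cmult_indicator emeasure_haar_translate)
  also have "\<dots> = emeasure M E * emeasure M U"
    using sum_emeasure[of Q T M] Q(1,3) T(1) QE by (simp add: sum_distrib_right[symmetric] image_subset_iff)
  finally show "emeasure M P * emeasure M O' \<le> emeasure M E * emeasure M U" .
qed

text \<open>Inner regularity is postulated for open sets only. For finite measure, take an open
  \<open>U\<close> around \<open>S\<close>, a compact \<open>K\<close> nearly exhausting
  \<open>U\<close>, and an open \<open>W\<close> barely larger than \<open>U - S\<close>; then
  \<open>K - W\<close> is compact and lies in \<open>S\<close>. What it misses of \<open>S\<close>
  lies in \<open>U - K\<close> or in \<open>S \<inter> W\<close>, each of measure at most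
  \<open>e / 2\<close>.\<close>

lemma haar_inner_approx_finite:
  assumes S: "S \<in> sets borel" "emeasure M S < \<infinity>" and e: "e > (0::real)"
  obtains K where "compact K" "K \<subseteq> S" "emeasure M S \<le> emeasure M K + e"
proof -
  have e2: "e / 2 > 0" using e by simp
  obtain U where U: "open U" "S \<subseteq> U" "emeasure M U < emeasure M S + ennreal 1"
    using haar_outer_approx[OF S zero_less_one] by metis
  have Ufin: "emeasure M U < \<infinity>" by (rule less_trans[OF U(3)]) (use S(2) in simp)
  have US: "U - S \<in> sets borel" "emeasure M (U - S) < \<infinity>"
    using U(1) S(1) emeasure_mono_finite[OF Diff_subset _ Ufin] by (simp_all add: sets_haar)
  obtain W where W: "open W" "U - S \<subseteq> W" "emeasure M W < emeasure M (U - S) + ennreal (e / 2)"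
    using haar_outer_approx[OF US e2] by metis
  obtain K where K: "compact K" "K \<subseteq> U" "emeasure M U < emeasure M K + ennreal (e / 2)"
  proof -
    have "\<exists>K\<in>{K. compact K \<and> K \<subseteq> U}. emeasure M U < emeasure M K + ennreal (e / 2)"
      using Ufin by (intro SUP_approx_ennreal[OF e2 _ emeasure_haar_inner[OF U(1)]]) auto
    then show ?thesis using that by blast
  qed
  have sets: "S \<in> sets M" "U \<in> sets M" "W \<in> sets M" "K \<in> sets M"
    using S U W K by (auto simp: sets_haar borel_compact)
  have "compact (K - W)" using K(1) W(1) by (intro compact_diff)
  moreover have "K - W \<subseteq> S" using K(2) W(2) by auto
  moreover have "emeasure M S \<le> emeasure M (K - W) + ennreal e"
  proof -
    have a: "emeasure M (U - K) \<le> ennreal (e / 2)"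
    proof -
      have "emeasure M K + emeasure M (U - K) = emeasure M U"
        using K(2) sets by (subst plus_emeasure) (auto intro!: arg_cong[where f="emeasure M"])
      then have "emeasure M K + emeasure M (U - K) \<le> emeasure M K + ennreal (e / 2)" using K(3) by simp
      then show ?thesis using emeasure_haar_compact[OF K(1)]
        by (auto simp: ennreal_add_left_cancel_le)
    qed
    \<comment> \<open>\<open>W\<close> contains the disjoint sets \<open>U - S\<close> and
      \<open>S \<inter> W\<close>; the finite measure of \<open>U - S\<close> can be
      cancelled.\<close>
    have b: "emeasure M (S \<inter> W) \<le> ennreal (e / 2)"
    proof -
      have "emeasure M (U - S) + emeasure M (S \<inter> W) = emeasure M ((U - S) \<union> (S \<inter> W))"
        using sets by (intro plus_emeasure) auto
      also have "\<dots> \<le> emeasure M W" using W(2) sets by (intro emeasure_mono) auto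
      also have "\<dots> \<le> emeasure M (U - S) + ennreal (e / 2)" using W(3) by simp
      finally show ?thesis using US(2)
        by (auto simp: ennreal_add_left_cancel_le)
    qed
    have "emeasure M S \<le> emeasure M ((K - W) \<union> ((U - K) \<union> (S \<inter> W)))"
      using U(2) sets by (intro emeasure_mono) auto
    also have "\<dots> \<le> emeasure M (K - W) + emeasure M ((U - K) \<union> (S \<inter> W))"
      using sets by (intro emeasure_subadditive) auto
    also have "\<dots> \<le> emeasure M (K - W) + (emeasure M (U - K) + emeasure M (S \<inter> W))"
      using sets by (intro add_left_mono emeasure_subadditive) auto
    also have "\<dots> \<le> emeasure M (K - W) + (ennreal (e / 2) + ennreal (e / 2))"
      by (intro add_left_mono add_mono a b)
    also have "\<dots> = emeasure M (K - W) + ennreal e" using e by (simp flip: ennreal_plus)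
    finally show ?thesis .
  qed
  ultimately show ?thesis using that by blast
qed

lemma integrable_haar_translate:
  fixes h :: "'g \<Rightarrow> complex"
  assumes "integrable M h"
  shows "integrable M (\<lambda>y. h (a + y))"
proof -
  have m: "(\<lambda>y. a + y) \<in> measurable M M"
    unfolding measurable_cong_sets[OF sets_haar sets_haar]
    by (intro borel_measurable_continuous_onI continuous_intros)
  have "distr M M (\<lambda>y. a + y) = M"
  proof (rule measure_eqI)
    fix B assume "B \<in> sets (distr M M (\<lambda>y. a + y))"
    then have B: "B \<in> sets borel" by (simp add: sets_haar)
    have "(\<lambda>y. a + y) -` B = (+) (- a) ` B"
      by (force simp: image_iff add.assoc[symmetric])
    then show "emeasure (distr M M (\<lambda>y. a + y)) B = emeasure M B"
      using B by (simp add: emeasure_distr m sets_haar space_haar emeasure_haar_translate)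
  qed simp
  then show ?thesis using assms integrable_distr[OF m, of h] by simp
qed

section \<open>Inversion on a locally compact group: null sets, and comparison of measures in the
  unimodular case\<close>

context
  assumes lc: "locally_compact_space (euclidean :: 'g topology)"
begin

lemma compact_neighbourhood_zero:
  obtains V C :: "'g set" where "open V" "0 \<in> V" "V \<subseteq> C" "compact C"
proof -
  obtain V C :: "'g set" where "open V" "0 \<in> V" "V \<subseteq> C" "compact C"
    using lc unfolding locally_compact_space_def
    by (metis UNIV_I compactin_euclidean_iff open_openin topspace_euclidean)
  then show ?thesis by (rule that)
qed

text \<open>The covering estimate with \<open>O' = V\<close> and \<open>E = C + P\<close> has
  right-hand side \<open>0\<close>, while \<open>V\<close> has positive measure.\<close>

lemma emeasure_null_uminus_compact:
  assumes P: "compact P" and null: "emeasure M (uminus ` P) = 0"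
  shows "emeasure M P = 0"
proof -
  obtain V C :: "'g set" where V: "open V" "0 \<in> V" "V \<subseteq> C" "compact C"
    using compact_neighbourhood_zero .
  have "emeasure M P * emeasure M V \<le>
      emeasure M ((\<lambda>(a, b). a + b) ` (C \<times> P)) * emeasure M (uminus ` P)"
    using V P by (intro emeasure_mult_le_emeasure_uminus_compact compact_group_sums) auto
  moreover have "emeasure M V > 0" using V by (intro haar_open_pos) auto
  ultimately show ?thesis using null by auto
qed

text \<open>Reduction to compact subsets \<open>K\<close> of the reflected null set:
  \<open>- K\<close> lies in \<open>N\<close>, hence \<open>K\<close> is null. Intersecting with
  \<open>B\<close> supplies the finite measure that inner approximation requires, so the conclusion
  is local nullity.\<close>

lemma emeasure_null_uminus_finite:
  assumes N: "N \<in> sets borel" "emeasure M N = 0"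
    and B: "B \<in> sets borel" "emeasure M B < \<infinity>"
  shows "emeasure M (B \<inter> uminus ` N) = 0"
proof -
  let ?S = "B \<inter> uminus ` N"
  have S: "?S \<in> sets borel" "emeasure M ?S < \<infinity>"
    using B borel_uminus_image[OF N(1)]
    using emeasure_mono_finite[of ?S B M] by (simp_all add: sets_haar)
  have "emeasure M ?S \<le> 0"
  proof (rule ennreal_le_epsilon)
    fix e :: real assume "e > 0"
    then obtain K where K: "compact K" "K \<subseteq> ?S" "emeasure M ?S \<le> emeasure M K + e"
      using haar_inner_approx_finite[OF S] by blast
    have "uminus ` K \<subseteq> N" using K(2) by auto
    then have "emeasure M (uminus ` K) = 0"
      using N by (metis emeasure_eq_0 sets_haar)
    then show "emeasure M ?S \<le> 0 + ennreal e"
      using emeasure_null_uminus_compact[OF K(1)] K(3) by simp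
  qed
  then show ?thesis by simp
qed

text \<open>The points where \<open>g (- y + z)\<close> violates the bound form a translate of a
  reflected null set, which is only known to be locally null. This suffices, because an integrable
  \<open>F\<close> lives on the countable union of the sets \<open>norm (F y) > 1 / Suc n\<close>,
  each of finite measure by Markov's inequality, and the claim is trivial where \<open>F\<close>
  vanishes.\<close>

lemma AE_reflected_mult_bounded:
  fixes F g :: "'g \<Rightarrow> complex"
  assumes F: "integrable M F" and g: "g \<in> borel_measurable M" and bd: "AE y in M. norm (g y) \<le> C"
  shows "AE y in M. norm (F y * g (- y + z)) \<le> \<bar>C\<bar> * norm (F y)"
proof -
  define N where "N = {y. norm (g y) > C}"
  have N: "N \<in> sets borel" "emeasure M N = 0"
  proof -
    have "N = {y \<in> space M. norm (g y) > C}" by (simp add: N_def space_haar)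
    then have "N \<in> sets M" using g by simp
    then show "N \<in> sets borel" by (simp add: sets_haar)
    show "emeasure M N = 0"
      using bd AE_iff_measurable[OF \<open>N \<in> sets M\<close>, of "\<lambda>y. norm (g y) \<le> C"]
      by (auto simp: N_def space_haar not_le)
  qed
  have null: "AE y in M. \<not> (norm (F y) > 1 / Suc n \<and> - y + z \<in> N)" for n
  proof -
    define B where "B = {y. norm (F y) > 1 / Suc n}"
    have FM: "F \<in> borel_measurable M" using F by auto
    have "B = {y \<in> space M. norm (F y) > 1 / Suc n}" by (simp add: B_def space_haar)
    then have Bs: "B \<in> sets M" using FM by simp
    have "emeasure M {y\<in>UNIV. 1 / Suc n \<le> norm (F y)} < \<infinity>"
      using integral_Markov_inequality[of "M" "\<lambda>y. norm (F y)" "1 / Suc n"] F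
      by (auto simp: space_haar intro: le_less_trans)
    moreover have "{y. 1 / Suc n \<le> norm (F y)} \<in> sets M"
      using FM measurable_sets[of "\<lambda>y. norm (F y)" M borel "{1 / Suc n..}"] 
      by (auto simp: vimage_def space_haar)
    ultimately have Bfin: "emeasure M B < \<infinity>"
      unfolding B_def by (elim emeasure_mono_finite[rotated 2]) auto
    \<comment> \<open>Since \<open>- z + y = - (- y + z)\<close>, a left translation by
      \<open>- z\<close> turns the bad part of \<open>B\<close> into a subset of the reflection of
      \<open>N\<close>.\<close>
    have B': "(+) (- z) ` B \<in> sets borel" "emeasure M ((+) (- z) ` B) < \<infinity>"
      using Bs Bfin by (auto simp: sets_haar borel_translation emeasure_haar_translate)
    let ?D = "(+) (- z) ` B \<inter> uminus ` N"
    have Ds: "?D \<in> sets borel" using B'(1) borel_uminus_image[OF N(1)] by auto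
    have "emeasure M ((+) z ` ?D) = 0"
      using emeasure_null_uminus_finite[OF N B'] by (simp add: emeasure_haar_translate Ds)
    then have "(+) z ` ?D \<in> null_sets M"
      using borel_translation[OF Ds] by (auto simp: null_sets_def sets_haar)
    moreover have "y \<in> (+) z ` ?D" if "y \<in> B" "- y + z \<in> N" for y
    proof (rule image_eqI[of _ _ "- z + y"])
      have "- z + y = - (- y + z)" by (simp add: minus_add)
      then show "- z + y \<in> ?D" using that by blast
    qed (simp add: add.assoc[symmetric])
    ultimately show ?thesis
      by (auto intro!: AE_I'[of "(+) z ` ?D"] simp: B_def)
  qed
  have "AE y in M. \<forall>n. \<not> (norm (F y) > 1 / Suc n \<and> - y + z \<in> N)"
    unfolding AE_all_countable using null by (rule allI)
  then show ?thesis
  proof (eventually_elim)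
    case (elim y)
    show ?case
    proof (cases "F y = 0")
      case False
      then obtain n where "1 / Suc n < norm (F y)"
        using reals_Archimedean[of "norm (F y)"] by (auto simp: inverse_eq_divide)
      then have "- y + z \<notin> N" using elim by blast
      then have "norm (g (- y + z)) \<le> \<bar>C\<bar>" by (simp add: N_def)
      then show ?thesis by (simp add: norm_mult mult.commute[of "\<bar>C\<bar>"] mult_left_mono)
    qed simp
  qed
qed

text \<open>For a compact \<open>P\<close> inside \<open>p + V\<close>, apply the covering estimate
  with \<open>O' = V - p\<close>. Right invariance gives \<open>O'\<close> the measure of
  \<open>V\<close>, and \<open>O' + P\<close> lies in \<open>C + C\<close>, so the constant is the
  same for every \<open>p\<close>. The bound then passes to small Borel sets, to all compact sets by
  partition, to open sets by inner regularity and to Borel sets by outer regularity.\<close>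

lemma unimodular_emeasure_uminus_le:
  assumes um: "unimodular M"
  obtains c where "c < \<infinity>" "\<And>B. B \<in> sets borel \<Longrightarrow> emeasure M (uminus ` B) \<le> c * emeasure M B"
proof -
  obtain V C :: "'g set" where V: "open V" "0 \<in> V" "V \<subseteq> C" "compact C"
    using compact_neighbourhood_zero .
  define E where "E = (\<lambda>(a, b). a + b) ` (C \<times> C)"
  have E: "compact E" using V(4) by (simp add: E_def compact_group_sums)
  have Vpos: "emeasure M V > 0" using V by (intro haar_open_pos) auto
  have "emeasure M V \<le> emeasure M C"
    using V by (intro emeasure_mono) (auto simp: sets_haar borel_compact)
  then have Vfin: "emeasure M V < \<infinity>" using emeasure_haar_compact[OF V(4)] by simp
  define c where "c = emeasure M E / emeasure M V"
  have c: "c < \<infinity>"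
    using emeasure_haar_compact[OF E] Vpos by (auto simp: c_def ennreal_divide_eq_top_iff less_top[symmetric])
  have cle: "a \<le> c * b" if "a * emeasure M V \<le> emeasure M E * b" for a b
  proof -
    have "a = a * emeasure M V / emeasure M V"
      using Vpos Vfin by (simp add: ennreal_mult_divide_eq)
    also have "\<dots> \<le> emeasure M E * b / emeasure M V"
      by (intro divide_right_mono_ennreal that)
    also have "\<dots> = c * b" by (simp add: c_def divide_ennreal_def mult_ac)
    finally show ?thesis .
  qed
  have small_compact: "emeasure M P \<le> c * emeasure M (uminus ` P)"
    if P: "compact P" "P \<subseteq> (+) p ` V" for P p
  proof (rule cle)
    have "emeasure M V = emeasure M ((\<lambda>y. y + - p) ` V)"
      using um V unfolding unimodular_def by (metis borel_open)
    moreover have "emeasure M P * emeasure M ((\<lambda>y. y + - p) ` V) \<le>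
        emeasure M E * emeasure M (uminus ` P)"
    proof (rule emeasure_mult_le_emeasure_uminus_compact[OF P(1) open_translation_right[OF V(1)] E])
      fix y q assume y: "y \<in> (\<lambda>y. y + - p) ` V" and q: "q \<in> P"
      obtain v where v: "v \<in> V" "y = v + - p" using y by auto
      obtain w where w: "w \<in> V" "q = p + w" using P(2) q by auto
      have "y + q = v + w" by (simp only: v w add.assoc minus_add_cancel)
      then show "y + q \<in> E" unfolding E_def using v(1) w(1) V(3) by force
    qed
    ultimately show "emeasure M P * emeasure M V \<le> emeasure M E * emeasure M (uminus ` P)"
      by simp
  qed
  have small: "emeasure M S \<le> c * emeasure M (uminus ` S)"
    if S: "S \<in> sets borel" "S \<subseteq> (+) p ` V" for S p
  proof (rule ennreal_le_epsilon)
    fix e :: real assume "e > 0"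
    have "emeasure M S \<le> emeasure M V"
      using S V emeasure_mono[OF S(2), of M] by (simp add: sets_haar open_translation_left emeasure_haar_translate)
    then have "emeasure M S < \<infinity>" using Vfin by simp
    then obtain K where K: "compact K" "K \<subseteq> S" "emeasure M S \<le> emeasure M K + e"
      using haar_inner_approx_finite[OF S(1) _ \<open>e > 0\<close>] by blast
    have "emeasure M K \<le> c * emeasure M (uminus ` K)"
      using small_compact[OF K(1)] K(2) S(2) by blast
    also have "\<dots> \<le> c * emeasure M (uminus ` S)"
      using K(2) S(1) by (intro mult_left_mono emeasure_mono) (auto simp: sets_haar borel_uminus_image)
    finally show "emeasure M S \<le> c * emeasure M (uminus ` S) + ennreal e"
      using K(3) by (meson add_right_mono order.trans)
  qed
  have compact: "emeasure M K \<le> c * emeasure M (uminus ` K)" if K: "compact K" for K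
  proof -
    obtain T where T: "finite T" "K \<subseteq> (\<Union>t\<in>T. (+) t ` V)"
      using compact_finite_translates[OF K V(1,2)] .
    obtain Q where Q: "\<And>t. t \<in> T \<Longrightarrow> Q t \<in> sets M" "\<And>t. t \<in> T \<Longrightarrow> Q t \<subseteq> K \<inter> (+) t ` V"
      "disjoint_family_on Q T" "(\<Union>t\<in>T. Q t) = (\<Union>t\<in>T. K \<inter> (+) t ` V)"
      by (rule finite_cover_disjoint_refinement[OF T(1), of "\<lambda>t. K \<inter> (+) t ` V" M])
        (use K V in \<open>auto simp: sets_haar borel_compact open_translation_left\<close>)
    have QK: "(\<Union>t\<in>T. Q t) = K" using Q(4) T(2) by auto
    have Qm: "uminus ` Q t \<in> sets M" if "t \<in> T" for t
      using Q(1)[OF that] by (simp add: sets_haar borel_uminus_image)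
    have "emeasure M K = (\<Sum>t\<in>T. emeasure M (Q t))"
      using sum_emeasure[of Q T M] Q(1,3) T(1) QK by (simp add: image_subset_iff)
    also have "\<dots> \<le> (\<Sum>t\<in>T. c * emeasure M (uminus ` Q t))"
    proof (rule sum_mono)
      fix t assume "t \<in> T"
      then show "emeasure M (Q t) \<le> c * emeasure M (uminus ` Q t)"
        using Q(1,2)[of t] by (intro small[of _ t]) (simp_all add: sets_haar)
    qed
    \<comment> \<open>Inversion keeps the pieces disjoint, so the number of pieces does not enter
      the constant.\<close>
    also have "\<dots> = c * emeasure M (\<Union>t\<in>T. uminus ` Q t)"
    proof -
      have "inj (uminus :: 'g \<Rightarrow> 'g)" by (simp add: inj_on_def)
      then have "disjoint_family_on (\<lambda>t. uminus ` Q t) T"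
        using Q(3) by (simp add: disjoint_family_on_def image_Int[symmetric])
      then show ?thesis
        using sum_emeasure[of "\<lambda>t. uminus ` Q t" T M] Qm T(1)
        by (simp add: sum_distrib_left[symmetric] image_subset_iff)
    qed
    also have "(\<Union>t\<in>T. uminus ` Q t) = uminus ` K" using QK by auto
    finally show ?thesis .
  qed
  \<comment> \<open>The direction of the inequality turns here: a compact \<open>K\<close> inside
    \<open>- U\<close> satisfies the previous bound, and \<open>- K\<close> lies in
    \<open>U\<close>.\<close>
  have opn: "emeasure M (uminus ` U) \<le> c * emeasure M U" if "open U" for U
  proof -
    have "emeasure M K \<le> c * emeasure M U" if K: "compact K" "K \<subseteq> uminus ` U" for K
    proof -
      have "uminus ` K \<subseteq> U" using K(2) by auto
      then have "emeasure M (uminus ` K) \<le> emeasure M U"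
        using \<open>open U\<close> by (intro emeasure_mono) (auto simp: sets_haar)
      then show ?thesis using compact[OF K(1)] by (meson mult_left_mono order.trans zero_le)
    qed
    then show ?thesis
      using that by (subst emeasure_haar_inner) (auto simp: open_uminus_image intro: SUP_least)
  qed
  have "emeasure M (uminus ` B) \<le> c * emeasure M B" if "B \<in> sets borel" for B
  proof (rule le_mult_emeasure_outer[OF that c])
    fix U assume U: "open U" "B \<subseteq> U"
    then have "emeasure M (uminus ` B) \<le> emeasure M (uminus ` U)"
      by (intro emeasure_mono) (auto simp: sets_haar open_uminus_image)
    then show "emeasure M (uminus ` B) \<le> c * emeasure M U" using opn[OF U(1)] by simp
  qed
  then show ?thesis using that c by blast
qed

text \<open>The image of \<open>M\<close> under inversion is dominated by the multiple
  \<open>scale_measure c M\<close>, and domination of measures passes to integrals of nonnegative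
  functions.\<close>

lemma unimodular_integrable_uminus:
  fixes g :: "'g \<Rightarrow> complex"
  assumes "unimodular M" "integrable M g"
  shows "integrable M (\<lambda>y. g (- y))"
proof -
  obtain c where c: "c < \<infinity>" "\<And>B. B \<in> sets borel \<Longrightarrow> emeasure M (uminus ` B) \<le> c * emeasure M B"
    using unimodular_emeasure_uminus_le[OF assms(1)] by metis
  have m: "uminus \<in> measurable M M"
    unfolding measurable_cong_sets[OF sets_haar sets_haar]
    by (intro borel_measurable_continuous_onI continuous_intros)
  let ?D = "distr M M uminus"
  have "?D \<le> scale_measure c M"
  proof -
    have "emeasure ?D B \<le> emeasure (scale_measure c M) B" for B
    proof (cases "B \<in> sets M")
      case True
      have "uminus -` B = uminus ` B" by (force simp: image_iff)
      then show ?thesis using True c(2)[of B] by (simp add: emeasure_distr m space_haar sets_haar)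
    qed (simp add: emeasure_notin_sets)
    then show ?thesis by (simp add: le_measure le_fun_def)
  qed
  then have "(\<integral>\<^sup>+y. norm (g y) \<partial>?D) \<le> (\<integral>\<^sup>+y. norm (g y) \<partial>scale_measure c M)"
    by (intro nn_integral_mono_measure) auto
  also have "\<dots> = c * (\<integral>\<^sup>+y. norm (g y) \<partial>M)"
    using assms(2) by (intro nn_integral_scale_measure) auto
  also have "\<dots> < \<infinity>"
    using c(1) assms(2) by (auto simp: integrable_iff_bounded ennreal_mult_less_top)
  finally have "integrable ?D g"
    using assms(2) by (auto simp: integrable_iff_bounded)
  then show ?thesis using integrable_distr[OF m] by blast
qed

end

end

section \<open>Convergent subnets\<close>

lemma directed_setD:
  assumes "directed_set D le"
  shows "D \<noteq> {}" "\<And>a. a \<in> D \<Longrightarrow> le a a"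
    "\<And>a b c. a \<in> D \<Longrightarrow> b \<in> D \<Longrightarrow> c \<in> D \<Longrightarrow> le a b \<Longrightarrow> le b c \<Longrightarrow> le a c"
    "\<And>a b. a \<in> D \<Longrightarrow> b \<in> D \<Longrightarrow> \<exists>c\<in>D. le a c \<and> le b c"
  using assms unfolding directed_set_def by blast+

lemma net_filter_neq_bot:
  assumes "directed_set D le" shows "net_filter D le \<noteq> bot"
proof
  assume "net_filter D le = bot"
  then have "eventually (\<lambda>_. False) (net_filter D le)" by simp
  then obtain a where "a \<in> D" "\<forall>b\<in>D. \<not> le a b"
    unfolding eventually_net_filter[OF assms] by blast
  then show False using directed_setD(2)[OF assms] by blast
qed

text \<open>Allows every limit and every eventual property along the net to be transferred to the
  subnet by composition. Cofinality reaches a given tail, and monotonicity keeps later indices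
  inside it.\<close>

lemma filterlim_subnet:
  assumes D: "directed_set D le" and sub: "subnet D le E le' \<phi>"
  shows "filterlim \<phi> (net_filter D le) (net_filter E le')"
  unfolding filterlim_iff
proof (intro allI impI)
  have E: "directed_set E le'" and img: "\<phi> ` E \<subseteq> D" and mono: "monotone_on E le' le \<phi>"
    and cof: "\<forall>a\<in>D. \<exists>\<eta>\<in>E. le a (\<phi> \<eta>)"
    using sub by (simp_all add: subnet_def)
  fix P assume "eventually P (net_filter D le)"
  then obtain a where a: "a \<in> D" "\<forall>b\<in>D. le a b \<longrightarrow> P b"
    unfolding eventually_net_filter[OF D] by blast
  obtain \<eta> where \<eta>: "\<eta> \<in> E" "le a (\<phi> \<eta>)" using cof a(1) by blast
  have "P (\<phi> \<eta>')" if "\<eta>' \<in> E" "le' \<eta> \<eta>'" for \<eta>'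
  proof -
    have "le (\<phi> \<eta>) (\<phi> \<eta>')" using monotone_onD[OF mono \<eta>(1) that] .
    then have "le a (\<phi> \<eta>')"
      using directed_setD(3)[OF D a(1) _ _ \<eta>(2)] img \<eta>(1) that(1) by blast
    then show ?thesis using a(2) img that(1) by blast
  qed
  then show "eventually (\<lambda>\<eta>. P (\<phi> \<eta>)) (net_filter E le')"
    unfolding eventually_net_filter[OF E] using \<eta>(1) by blast
qed

text \<open>Bolzano-Weierstrass, one coordinate at a time. Refining filters keeps the index type
  fixed, whereas passing to successive subnets would change it at each step.\<close>

lemma bounded_family_cluster_filter:
  fixes u :: "'a \<Rightarrow> 'b \<Rightarrow> 'c::heine_borel"
  assumes "finite J" "G \<noteq> bot" "\<And>j. j \<in> J \<Longrightarrow> bounded (S j)"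
    "\<And>j. j \<in> J \<Longrightarrow> eventually (\<lambda>\<theta>. u j \<theta> \<in> S j) G"
  obtains H lam where "H \<le> G" "H \<noteq> bot" "\<And>j. j \<in> J \<Longrightarrow> (u j \<longlongrightarrow> lam j) H"
proof -
  have "\<exists>H lam. H \<le> G \<and> H \<noteq> bot \<and> (\<forall>j\<in>J. (u j \<longlongrightarrow> lam j) H)"
    using assms
  proof (induction J rule: finite_induct)
    case empty
    then show ?case by auto
  next
    case (insert i J)
    then obtain H lam where H: "H \<le> G" "H \<noteq> bot" "\<forall>j\<in>J. (u j \<longlongrightarrow> lam j) H" by auto
    have "compact (closure (S i))"
      using insert.prems(2) by (simp add: compact_eq_bounded_closed bounded_closure)
    moreover have "filtermap (u i) H \<noteq> bot" using H(2) by (simp add: filtermap_bot_iff)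
    moreover have "eventually (\<lambda>x. x \<in> closure (S i)) (filtermap (u i) H)"
      using filter_leD[OF H(1) insert.prems(3)[of i]] closure_subset[of "S i"]
      by (auto simp: eventually_filtermap elim: eventually_mono)
    ultimately obtain l where l: "inf (nhds l) (filtermap (u i) H) \<noteq> bot"
      unfolding compact_filter by blast
    \<comment> \<open>Forces \<open>u i\<close> to converge to its cluster point \<open>l\<close>;
      the refinement is proper precisely because \<open>l\<close> is a cluster point along
      \<open>H\<close>.\<close>
    define H' where "H' = inf H (filtercomap (u i) (nhds l))"
    have "H' \<noteq> bot"
    proof
      assume "H' = bot"
      then have "eventually (\<lambda>_. False) H'" by simp
      then obtain P Q where PQ: "eventually P H" "eventually Q (filtercomap (u i) (nhds l))"
        "\<And>x. P x \<Longrightarrow> Q x \<Longrightarrow> False"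
        unfolding H'_def eventually_inf by blast
      then obtain R where R: "eventually R (nhds l)" "\<And>x. R (u i x) \<Longrightarrow> Q x"
        unfolding eventually_filtercomap by blast
      have "eventually (\<lambda>x. \<not> R x) (filtermap (u i) H)"
        unfolding eventually_filtermap using PQ(1) by (rule eventually_mono) (use PQ(3) R(2) in blast)
      then have "eventually (\<lambda>_. False) (inf (nhds l) (filtermap (u i) H))"
        unfolding eventually_inf using R(1) by blast
      then show False using l by (simp add: trivial_limit_def)
    qed
    moreover have "H' \<le> G" using H(1) unfolding H'_def by (meson inf_le1 order.trans)
    moreover have "(u i \<longlongrightarrow> l) H'"
      unfolding H'_def filterlim_def by (simp add: filtermap_le_iff_le_filtercomap)
    moreover have "(u j \<longlongrightarrow> lam j) H'" if "j \<in> J" for j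
      using H(3) that
      unfolding H'_def by (blast intro: tendsto_mono[OF inf_le1])
    ultimately show ?case
      using insert.hyps by (intro exI[of _ H'] exI[of _ "lam(i := l)"]) auto
  qed
  then show ?thesis using that by blast
qed

text \<open>A convergent refinement \<open>H\<close> of the net filter is turned back into a net: an
  index is a pair of some \<open>\<theta>\<close> and a precision \<open>n\<close> that the values
  at \<open>\<theta>\<close> attain, and \<open>\<phi>\<close> is the first projection.\<close>

lemma ex_subnet_convergent:
  fixes u :: "nat \<Rightarrow> 'i \<Rightarrow> complex"
  assumes D: "directed_set D le" and J: "finite J"
    and bd: "\<And>j \<theta>. j \<in> J \<Longrightarrow> \<theta> \<in> D \<Longrightarrow> norm (u j \<theta>) \<le> C"
  obtains E :: "('i \<times> nat) set" and le' \<phi> lam where "subnet D le E le' \<phi>"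
    "\<And>j. j \<in> J \<Longrightarrow> ((\<lambda>\<eta>. u j (\<phi> \<eta>)) \<longlongrightarrow> lam j) (net_filter E le')"
proof -
  note D' = directed_setD[OF D]
  have "eventually (\<lambda>\<theta>. u j \<theta> \<in> cball 0 C) (net_filter D le)" if "j \<in> J" for j
    unfolding eventually_net_filter[OF D] using bd[OF that] D'(1) by auto
  then obtain H lam where H: "H \<le> net_filter D le" "H \<noteq> bot" "\<And>j. j \<in> J \<Longrightarrow> (u j \<longlongrightarrow> lam j) H"
    using bounded_family_cluster_filter[OF J net_filter_neq_bot[OF D], of "\<lambda>_. cball 0 C" u]
    by (metis bounded_cball)
  define good where "good \<theta> n \<longleftrightarrow> (\<forall>j\<in>J. dist (u j \<theta>) (lam j) < 1 / Suc n)" for \<theta> n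
  \<comment> \<open>Both the tail beyond \<open>\<theta>\<close> and the condition
    \<open>good\<close> at level \<open>n\<close> hold eventually along \<open>H\<close>, which is
    proper, so they hold together somewhere.\<close>
  have cof: "\<exists>\<theta>'\<in>D. le \<theta> \<theta>' \<and> good \<theta>' n" if "\<theta> \<in> D" for \<theta> n
  proof -
    have "eventually (\<lambda>\<theta>'. \<theta>' \<in> D \<and> le \<theta> \<theta>') (net_filter D le)"
    proof -
      have "le \<theta> b" if "c \<in> D" "b \<in> D" "le \<theta> c" "le c b" for b c
        using D'(3)[OF \<open>\<theta> \<in> D\<close> that(1,2)] that by blast
      then have "eventually (\<lambda>\<theta>'. \<theta>' \<in> {b\<in>D. le \<theta> b}) (net_filter D le)"
        unfolding net_filter_def using that
        by (intro eventually_INF1[of \<theta>]) (auto simp: eventually_principal)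
      then show ?thesis by simp
    qed
    then have "eventually (\<lambda>\<theta>'. \<theta>' \<in> D \<and> le \<theta> \<theta>') H" using H(1) filter_leD by blast
    moreover have "eventually (\<lambda>\<theta>'. good \<theta>' n) H"
      unfolding good_def using H(3) J
      by (intro eventually_ball_finite ballI) (auto intro!: tendstoD)
    ultimately have "eventually (\<lambda>\<theta>'. (\<theta>' \<in> D \<and> le \<theta> \<theta>') \<and> good \<theta>' n) H"
      by (rule eventually_conj)
    then show ?thesis using H(2) eventually_happens by blast
  qed
  define E where "E = {(\<theta>, n). \<theta> \<in> D \<and> good \<theta> n}"
  define le' where "le' p q \<longleftrightarrow> le (fst p) (fst q) \<and> snd p \<le> snd q" for p q :: "'i \<times> nat"
  have E: "directed_set E le'"
    unfolding directed_set_def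
  proof (intro conjI ballI impI)
    show "E \<noteq> {}" using D'(1) cof[of _ 0] by (fastforce simp: E_def)
    show "le' a a" if "a \<in> E" for a using that D'(2) by (auto simp: E_def le'_def)
    show "le' a c" if "a \<in> E" "b \<in> E" "c \<in> E" "le' a b" "le' b c" for a b c
      using that D'(3)[of "fst a" "fst b" "fst c"] by (auto simp: E_def le'_def)
    show "\<exists>c\<in>E. le' a c \<and> le' b c" if "a \<in> E" "b \<in> E" for a b
    proof -
      have ab: "fst a \<in> D" "fst b \<in> D" using that by (auto simp: E_def)
      then obtain c where c: "c \<in> D" "le (fst a) c" "le (fst b) c" using D'(4) by blast
      \<comment> \<open>A common bound \<open>c\<close> of the first components need not be good, so
        one moves further out to an index that attains the larger of the two precisions.\<close>
      obtain d where d: "d \<in> D" "le c d" "good d (max (snd a) (snd b))" using cof[OF c(1)] by blast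
      have "le (fst a) d" "le (fst b) d" using D'(3) ab c d by blast+
      then show ?thesis using d
        by (intro bexI[of _ "(d, max (snd a) (snd b))"]) (auto simp: E_def le'_def)
    qed
  qed
  have "subnet D le E le' fst"
    unfolding subnet_def
  proof (intro conjI E)
    show "fst ` E \<subseteq> D" by (auto simp: E_def)
    show "monotone_on E le' le fst" by (auto simp: monotone_on_def le'_def)
    show "\<forall>a\<in>D. \<exists>\<eta>\<in>E. le a (fst \<eta>)" using cof[of _ 0] by (fastforce simp: E_def)
  qed
  moreover have "((\<lambda>\<eta>. u j (fst \<eta>)) \<longlongrightarrow> lam j) (net_filter E le')" if j: "j \<in> J" for j
  proof (rule tendstoI)
    fix e :: real assume "e > 0"
    then obtain n where n: "1 / Suc n < e"
      using reals_Archimedean[of e] by (auto simp: inverse_eq_divide)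
    obtain \<theta> where \<theta>: "(\<theta>, n) \<in> E" using D'(1) cof[of _ n] by (fastforce simp: E_def)
    have "dist (u j (fst \<eta>)) (lam j) < e" if "\<eta> \<in> E" "le' (\<theta>, n) \<eta>" for \<eta>
    proof -
      have "dist (u j (fst \<eta>)) (lam j) < 1 / Suc (snd \<eta>)"
        using that(1) j by (auto simp: E_def good_def)
      also have "\<dots> \<le> 1 / Suc n" using that(2) by (simp add: le'_def frac_le)
      finally show ?thesis using n by simp
    qed
    then show "\<forall>\<^sub>F \<eta> in net_filter E le'. dist (u j (fst \<eta>)) (lam j) < e"
      unfolding eventually_net_filter[OF E] using \<theta> by blast
  qed
  ultimately show ?thesis by (rule that)
qed

section \<open>Convolution and limits along the partition\<close>

lemma norm_set_integral_le:
  fixes f :: "'a \<Rightarrow> complex"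
  assumes "integrable M f" "B \<in> sets M"
  shows "norm (LINT y:B|M. f y) \<le> (LINT y|M. norm (f y))"
proof -
  have i: "integrable M (\<lambda>y. indicator B y *\<^sub>R f y)"
    using assms(2,1) by (rule integrable_mult_indicator)
  have "norm (LINT y:B|M. f y) \<le> (LINT y|M. norm (indicator B y *\<^sub>R f y))"
    unfolding set_lebesgue_integral_def by (rule integral_norm_bound)
  also have "\<dots> \<le> (LINT y|M. norm (f y))"
    using i assms(1) by (intro integral_mono integrable_norm) (auto simp: indicator_def)
  finally show ?thesis .
qed

text \<open>Common core of both convergence assertions: bounded and integrable \<open>g\<close>
  differ only in how \<open>gint\<close> and \<open>gtail\<close> are verified. Integrability is
  demanded only away from the identity; near it, closeness to the step function provides it.\<close>

lemma convolution_tendsto_of_tails: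
  fixes M :: "'g::{topological_group_add, t2_space} measure"
    and F :: "'j \<Rightarrow> 'g \<Rightarrow> complex" and g :: "'g \<Rightarrow> complex"
  assumes haar: "left_haar_measure M"
    and part: "local_partition M k A"
    and F: "\<forall>\<^sub>F \<eta> in \<F>. integrable M (F \<eta>) \<and> (LINT y|M. norm (F \<eta> y)) \<le> C"
    and tail: "\<And>N. open N \<Longrightarrow> 0 \<in> N \<Longrightarrow> ((\<lambda>\<eta>. LINT y:-N|M. norm (F \<eta> y)) \<longlongrightarrow> 0) \<F>"
    and lam: "\<forall>j\<in>{1..k}. ((\<lambda>\<eta>. LINT y:A j|M. F \<eta> y) \<longlongrightarrow> lam j) \<F>"
    and g: "g \<in> borel_measurable M"
    and lim: "\<forall>j\<in>{1..k}. limit_along g z (A j) (K j)"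
    and gint: "\<And>N. open N \<Longrightarrow> 0 \<in> N \<Longrightarrow>
      \<forall>\<^sub>F \<eta> in \<F>. set_integrable M (-N) (\<lambda>y. F \<eta> y * g (- y + z))"
    and gtail: "\<And>N. open N \<Longrightarrow> 0 \<in> N \<Longrightarrow>
      ((\<lambda>\<eta>. LINT y:-N|M. norm (F \<eta> y * g (- y + z))) \<longlongrightarrow> 0) \<F>"
  shows "convolution_tendsto M F g z (\<Sum>j=1..k. lam j * K j) \<F>"
proof -
  note sets = sets_haar[OF haar] and space = space_haar[OF haar]
  define G where "G y = g (- y + z)" for y
  have G: "G \<in> borel_measurable M"
  proof -
    have "(\<lambda>y. - y + z) \<in> measurable M M"
      unfolding measurable_cong_sets[OF sets sets]
      by (intro borel_measurable_continuous_onI continuous_intros)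
    then show ?thesis unfolding G_def using g by (rule measurable_compose)
  qed
  have A: "A j \<in> sets M" if "j \<in> {1..k}" for j
    using part that by (simp add: local_partition_def sets)
  have disj: "disjoint_family_on A {1..k}"
    using part by (simp add: local_partition_def)
  define s where "s y = (\<Sum>j=1..k. indicator (A j) y *\<^sub>R K j)" for y
  have s: "s \<in> borel_measurable M"
    unfolding s_def using A by (intro borel_measurable_sum borel_measurable_scaleR) auto
  define S where "S = (\<Sum>j=1..k. norm (K j))"
  have sS: "norm (s y) \<le> S" for y
    unfolding s_def S_def by (intro sum_norm_le) (simp add: indicator_def)
  have sA: "s y = K j" if "j \<in> {1..k}" "y \<in> A j" for j y
  proof -
    have "y \<notin> A i" if "i \<in> {1..k}" "i \<noteq> j" for i
      using disjoint_family_onD[OF disj that(1) \<open>j \<in> {1..k}\<close> that(2)] \<open>y \<in> A j\<close> by blast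
    then have "s y = (\<Sum>i=1..k. if i = j then K j else 0)"
      unfolding s_def using \<open>y \<in> A j\<close> by (intro sum.cong) auto
    then show ?thesis using that(1) by simp
  qed
  have cover: "AE y in M. y \<in> (\<Union>j\<in>{1..k}. A j)"
  proof (rule AE_I)
    show "emeasure M (UNIV - (\<Union>j\<in>{1..k}. A j)) = 0" using part by (simp add: local_partition_def)
    show "UNIV - (\<Union>j\<in>{1..k}. A j) \<in> sets M"
      using A sets.top[of M] unfolding space by (intro sets.Diff sets.finite_UN) auto
  qed auto
  \<comment> \<open>Intersect the finitely many neighbourhoods that belong to the sets
    \<open>A j\<close>. The bound holds only almost everywhere, as the partition may miss a null
    set.\<close>
  have near: "\<exists>N. open N \<and> 0 \<in> N \<and> (AE y in M. y \<in> N \<longrightarrow> norm (G y - s y) \<le> e)" if "e > 0" for e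
  proof -
    have "\<forall>j\<in>{1..k}. \<exists>N. open N \<and> 0 \<in> N \<and> (\<forall>y\<in>N \<inter> A j. norm (G y - K j) < e)"
      using lim \<open>e > 0\<close> unfolding limit_along_iff G_def by blast
    then obtain N where N: "\<forall>j\<in>{1..k}. open (N j) \<and> 0 \<in> N j \<and> (\<forall>y\<in>N j \<inter> A j. norm (G y - K j) < e)"
      by metis
    let ?N = "\<Inter>j\<in>{1..k}. N j"
    have "AE y in M. y \<in> ?N \<longrightarrow> norm (G y - s y) \<le> e"
      using cover
    proof (eventually_elim, intro impI)
      fix y assume "y \<in> (\<Union>j\<in>{1..k}. A j)" and yN: "y \<in> ?N"
      then obtain j where j: "j \<in> {1..k}" "y \<in> A j" by blast
      then have "norm (G y - K j) < e" using N yN by blast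
      then show "norm (G y - s y) \<le> e" using sA[OF j] by simp
    qed
    moreover have "open ?N" "0 \<in> ?N" using N by (auto intro!: open_INT)
    ultimately show ?thesis by blast
  qed
  have Fs: "integrable M (\<lambda>y. f y * s y) \<and> (LINT y|M. f y * s y) = (\<Sum>j=1..k. (LINT y:A j|M. f y) * K j)"
    if f: "integrable M f" for f :: "'g \<Rightarrow> complex"
  proof -
    have eq: "f y * s y = (\<Sum>j=1..k. (indicator (A j) y *\<^sub>R f y) * K j)" for y
      by (simp add: s_def sum_distrib_left)
    have i: "integrable M (\<lambda>y. (indicator (A j) y *\<^sub>R f y) * K j)" if "j \<in> {1..k}" for j
      using integrable_mult_indicator[OF A[OF that] f] by (rule integrable_mult_left)
    show ?thesis
      unfolding eq set_lebesgue_integral_def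
      using Bochner_Integration.integrable_sum[of "{1..k}", OF i]
        Bochner_Integration.integral_sum[of "{1..k}", OF i]
      by (simp only: integral_mult_left_zero simp_thms)
  qed
  have key: "integrable M (\<lambda>y. f y * G y) \<and> norm ((LINT y|M. f y * G y) - (LINT y|M. f y * s y)) \<le>
      e * (LINT y|M. norm (f y)) + (LINT y:-N|M. norm (f y * G y)) + S * (LINT y:-N|M. norm (f y))"
    if f: "integrable M f" and fG: "set_integrable M (-N) (\<lambda>y. f y * G y)" and "open N"
      and e: "AE y in M. y \<in> N \<longrightarrow> norm (G y - s y) \<le> e" "e > 0"
    for f :: "'g \<Rightarrow> complex" and N e
  proof -
    have Ns: "- N \<in> sets M"
      using \<open>open N\<close> unfolding sets by (intro borel_closed closed_Compl)
    have i1: "integrable M (\<lambda>y. indicator (-N) y * norm (f y))"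
      using integrable_mult_indicator[OF Ns integrable_norm[OF f]] by simp
    have i2: "integrable M (\<lambda>y. indicator (-N) y * norm (f y * G y))"
      using integrable_norm[OF fG[unfolded set_integrable_def]] by simp
    \<comment> \<open>The first term dominates on \<open>N\<close>, the other two off
      \<open>N\<close>, where \<open>G\<close> and \<open>s\<close> are estimated
      separately.\<close>
    let ?h = "\<lambda>y. e * norm (f y) + indicator (-N) y * norm (f y * G y) + S * (indicator (-N) y * norm (f y))"
    have ih: "integrable M ?h"
      using f i1 i2 by (intro Bochner_Integration.integrable_add integrable_mult_right integrable_norm)
    have bd: "AE y in M. norm (f y * (G y - s y)) \<le> ?h y"
      using e(1)
    proof eventually_elim
      case (elim y)
      show ?case
      proof (cases "y \<in> N")
        case True
        then show ?thesis using elim by (simp add: norm_mult mult.commute[of e] mult_left_mono)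
      next
        case False
        have "norm (f y * (G y - s y)) \<le> norm (f y * G y) + norm (f y * s y)"
          by (simp add: right_diff_distrib norm_triangle_ineq4)
        also have "norm (f y * s y) \<le> S * norm (f y)"
          using sS[of y] by (simp add: norm_mult mult.commute[of S] mult_left_mono)
        finally have "norm (f y * (G y - s y)) \<le> norm (f y * G y) + S * norm (f y)" by simp
        moreover have "0 \<le> e * norm (f y)" using e(2) by simp
        moreover have "indicator (-N) y = (1 :: real)" using False by simp
        ultimately show ?thesis by simp
      qed
    qed
    have fm: "f \<in> borel_measurable M" using f by simp
    have d: "integrable M (\<lambda>y. f y * (G y - s y))"
    proof (rule Bochner_Integration.integrable_bound[OF ih])
      show "(\<lambda>y. f y * (G y - s y)) \<in> borel_measurable M" using fm G s by measurable
      show "AE y in M. norm (f y * (G y - s y)) \<le> norm (?h y)"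
        using bd by eventually_elim (unfold real_norm_def, erule order.trans, rule abs_ge_self)
    qed
    \<comment> \<open>The product is the sum of \<open>f y * (G y - s y)\<close>, dominated by
      \<open>?h\<close>, and \<open>f y * s y\<close>.\<close>
    have fGi: "integrable M (\<lambda>y. f y * G y)"
      using Bochner_Integration.integrable_add[OF d conjunct1[OF Fs[OF f]]]
      by (simp add: right_diff_distrib)
    have "(LINT y|M. f y * G y) - (LINT y|M. f y * s y) = (LINT y|M. f y * (G y - s y))"
      using fGi conjunct1[OF Fs[OF f]] by (simp add: right_diff_distrib)
    also have "norm \<dots> \<le> (LINT y|M. norm (f y * (G y - s y)))"
      by (rule integral_norm_bound)
    also have "\<dots> \<le> (LINT y|M. ?h y)"
      using d ih bd by (intro integral_mono_AE integrable_norm)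
    also have "\<dots> = e * (LINT y|M. norm (f y)) + (LINT y:-N|M. norm (f y * G y)) + S * (LINT y:-N|M. norm (f y))"
      using f i1 i2 by (simp add: set_lebesgue_integral_def)
    finally show ?thesis using fGi by blast
  qed
  have "((\<lambda>\<eta>. (LINT y|M. F \<eta> y * G y) - (LINT y|M. F \<eta> y * s y)) \<longlongrightarrow> 0) \<F>"
  proof (rule tendstoI)
    fix \<epsilon> :: real assume \<epsilon>: "\<epsilon> > 0"
    \<comment> \<open>Chosen so that \<open>e * C\<close> is at most \<open>\<epsilon> / 2\<close>;
      the form \<open>\<bar>C\<bar> + 1\<close> keeps the denominator positive for every real
      \<open>C\<close>.\<close>
    define e where "e = \<epsilon> / (2 * (\<bar>C\<bar> + 1))"
    have e: "e > 0" using \<epsilon> by (simp add: e_def)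
    have eC: "e * C \<le> \<epsilon> / 2"
    proof -
      have "e * C \<le> e * (\<bar>C\<bar> + 1)" using e by (intro mult_left_mono) auto
      also have "\<dots> = \<epsilon> / 2" by (simp add: e_def field_simps)
      finally show ?thesis .
    qed
    obtain N where N: "open N" "0 \<in> N" "AE y in M. y \<in> N \<longrightarrow> norm (G y - s y) \<le> e"
      using near[OF e] by blast
    have "((\<lambda>\<eta>. (LINT y:-N|M. norm (F \<eta> y * G y)) + S * (LINT y:-N|M. norm (F \<eta> y))) \<longlongrightarrow> 0 + S * 0) \<F>"
      using gtail[OF N(1,2)] tail[OF N(1,2)] unfolding G_def by (intro tendsto_intros)
    then have "\<forall>\<^sub>F \<eta> in \<F>. (LINT y:-N|M. norm (F \<eta> y * G y)) + S * (LINT y:-N|M. norm (F \<eta> y)) < \<epsilon> / 2"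
      by (rule order_tendstoD) (use \<epsilon> in simp)
    with F gint[OF N(1,2)]
    show "\<forall>\<^sub>F \<eta> in \<F>. dist ((LINT y|M. F \<eta> y * G y) - (LINT y|M. F \<eta> y * s y)) 0 < \<epsilon>"
    proof eventually_elim
      case (elim \<eta>)
      have "e * (LINT y|M. norm (F \<eta> y)) \<le> e * C" using elim e by (intro mult_left_mono) auto
      then show ?case
        using key[OF conjunct1[OF elim(1)] elim(2)[folded G_def] N(1,3) e] elim(3) eC by simp
    qed
  qed
  moreover have "((\<lambda>\<eta>. LINT y|M. F \<eta> y * s y) \<longlongrightarrow> (\<Sum>j=1..k. lam j * K j)) \<F>"
  proof (rule Lim_transform_eventually)
    show "((\<lambda>\<eta>. \<Sum>j=1..k. (LINT y:A j|M. F \<eta> y) * K j) \<longlongrightarrow> (\<Sum>j=1..k. lam j * K j)) \<F>"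
      using lam by (intro tendsto_sum tendsto_mult tendsto_const) blast
    show "\<forall>\<^sub>F \<eta> in \<F>. (\<Sum>j=1..k. (LINT y:A j|M. F \<eta> y) * K j) = (LINT y|M. F \<eta> y * s y)"
      using F by eventually_elim (use Fs in simp)
  qed
  ultimately have "((\<lambda>\<eta>. LINT y|M. F \<eta> y * G y) \<longlongrightarrow> (\<Sum>j=1..k. lam j * K j)) \<F>"
    using tendsto_add by fastforce
  moreover have "\<forall>\<^sub>F \<eta> in \<F>. integrable M (\<lambda>y. F \<eta> y * G y)"
  proof -
    \<comment> \<open>Any fixed tolerance serves here, as only integrability is at stake.\<close>
    obtain N where N: "open N" "0 \<in> N" "AE y in M. y \<in> N \<longrightarrow> norm (G y - s y) \<le> 1"
      using near[of 1] by auto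
    show ?thesis
      using F gint[OF N(1,2)] by eventually_elim (use key[OF _ _ N(1,3)] in \<open>simp add: G_def\<close>)
  qed
  ultimately show ?thesis
    unfolding convolution_tendsto_def convolution_def convolution_defined_def G_def by blast
qed

section \<open>Tail estimates for bounded and for integrable functions\<close>

text \<open>With \<open>g\<close> essentially bounded, the product is dominated by a multiple of
  \<open>norm (F y)\<close>, so its tails inherit the decay of those of the approximate
  identity.\<close>

lemma set_integral_reflected_mult_bounded:
  fixes M :: "'g::{topological_group_add, t2_space} measure" and F g :: "'g \<Rightarrow> complex"
  assumes haar: "left_haar_measure M" and lc: "locally_compact_space (euclidean :: 'g topology)"
    and g: "g \<in> borel_measurable M" "AE y in M. norm (g y) \<le> C"
    and F: "integrable M F" and N: "N \<in> sets borel"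
  shows "set_integrable M N (\<lambda>y. F y * g (- y + z))"
    and "(LINT y:N|M. norm (F y * g (- y + z))) \<le> \<bar>C\<bar> * (LINT y:N|M. norm (F y))"
proof -
  note sets = sets_haar[OF haar]
  have NM: "N \<in> sets M" using N by (simp add: sets)
  have bd: "AE y in M. norm (F y * g (- y + z)) \<le> \<bar>C\<bar> * norm (F y)"
    by (rule AE_reflected_mult_bounded[OF haar lc F g])
  have "(\<lambda>y. - y + z) \<in> measurable M M"
    unfolding measurable_cong_sets[OF sets sets]
    by (intro borel_measurable_continuous_onI continuous_intros)
  then have gm: "(\<lambda>y. g (- y + z)) \<in> borel_measurable M" using g(1) by (rule measurable_compose)
  have Fg: "integrable M (\<lambda>y. F y * g (- y + z))"
  proof (rule Bochner_Integration.integrable_bound)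
    show "integrable M (\<lambda>y. \<bar>C\<bar> * norm (F y))" using F by simp
    show "(\<lambda>y. F y * g (- y + z)) \<in> borel_measurable M" using F gm by measurable
    show "AE y in M. norm (F y * g (- y + z)) \<le> norm (\<bar>C\<bar> * norm (F y))" using bd by simp
  qed
  show si: "set_integrable M N (\<lambda>y. F y * g (- y + z))"
    unfolding set_integrable_def by (rule integrable_mult_indicator[OF NM Fg])
  have "(LINT y:N|M. norm (F y * g (- y + z))) \<le> (LINT y:N|M. \<bar>C\<bar> * norm (F y))"
    unfolding set_lebesgue_integral_def
  proof (rule integral_mono_AE)
    show "integrable M (\<lambda>y. indicator N y *\<^sub>R norm (F y * g (- y + z)))"
      by (rule integrable_mult_indicator[OF NM integrable_norm[OF Fg]])
    show "integrable M (\<lambda>y. indicator N y *\<^sub>R (\<bar>C\<bar> * norm (F y)))"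
      using F by (intro integrable_mult_indicator[OF NM]) simp
    show "AE y in M. indicator N y *\<^sub>R norm (F y * g (- y + z)) \<le> indicator N y *\<^sub>R (\<bar>C\<bar> * norm (F y))"
      using bd by eventually_elim (simp add: indicator_def)
  qed
  then show "(LINT y:N|M. norm (F y * g (- y + z))) \<le> \<bar>C\<bar> * (LINT y:N|M. norm (F y))"
    by simp
qed

text \<open>Counterpart with the roles exchanged: \<open>F\<close> is uniformly small on
  \<open>N\<close> and \<open>h\<close>, later the reflected translate of \<open>g\<close>, carries
  the integrability. An \<open>ennreal\<close> supremum below a real number encodes actual
  boundedness.\<close>

lemma set_integral_mult_bounded:
  fixes F h :: "'a \<Rightarrow> complex"
  assumes N: "N \<in> sets M" and F: "F \<in> borel_measurable M" and h: "integrable M h"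
    and e: "e \<ge> 0" "(SUP y\<in>N. ennreal (norm (F y))) \<le> ennreal e"
  shows "set_integrable M N (\<lambda>y. F y * h y)"
    and "(LINT y:N|M. norm (F y * h y)) \<le> e * (LINT y|M. norm (h y))"
proof -
  have Fe: "norm (F y) \<le> e" if "y \<in> N" for y
    using order.trans[OF SUP_upper[OF that] e(2)] e(1) by simp
  have bd: "indicator N y * norm (F y * h y) \<le> e * norm (h y)" for y
    using Fe[of y] e(1) by (auto simp: indicator_def norm_mult intro: mult_right_mono)
  have ih: "integrable M (\<lambda>y. e * norm (h y))" using h by simp
  show si: "set_integrable M N (\<lambda>y. F y * h y)"
    unfolding set_integrable_def
  proof (rule Bochner_Integration.integrable_bound[OF ih])
    show "(\<lambda>y. indicator N y *\<^sub>R (F y * h y)) \<in> borel_measurable M"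
      using N F h by measurable
    show "AE y in M. norm (indicator N y *\<^sub>R (F y * h y)) \<le> norm (e * norm (h y))"
      using bd e(1) by (auto simp: abs_mult)
  qed
  show "(LINT y:N|M. norm (F y * h y)) \<le> e * (LINT y|M. norm (h y))"
  proof -
    have "(LINT y:N|M. norm (F y * h y)) \<le> (LINT y|M. e * norm (h y))"
      unfolding set_lebesgue_integral_def
      using integrable_norm[OF si[unfolded set_integrable_def]] ih bd
      by (intro integral_mono) auto
    then show ?thesis by simp
  qed
qed

text \<open>The subnet and the \<open>lam j\<close> are extracted from the integrals of
  \<open>F \<theta>\<close> over the \<open>A j\<close> alone, independently of \<open>f\<close> and
  \<open>x\<close>; hence one subnet serves all \<open>g\<close> and \<open>z\<close> in the second
  assertion.\<close>

theorem corollary2p2: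
  fixes M :: "'g::{topological_group_add, t2_space} measure"
    and \<Theta> :: "'i set" and le :: "'i \<Rightarrow> 'i \<Rightarrow> bool"
    and F :: "'i \<Rightarrow> 'g \<Rightarrow> complex"
    and k :: nat and A :: "nat \<Rightarrow> 'g set"
    and f :: "'g \<Rightarrow> complex" and x :: 'g and L :: "nat \<Rightarrow> complex"
  assumes "locally_compact_space (euclidean :: 'g topology)"
    and "left_haar_measure M"
    and "approximate_identity M \<Theta> le F"
    and "local_partition M k A"
    and "L_infinity M f"
    and "\<forall>j\<in>{1..k}. limit_along f x (A j) (L j)"
  shows "\<exists>(\<Theta>1 :: ('i \<times> nat) set) le1 \<phi> lam.
    subnet \<Theta> le \<Theta>1 le1 \<phi> \<and>
    (\<forall>j\<in>{1..k}. ((\<lambda>\<eta>. LINT y:A j|M. F (\<phi> \<eta>) y) \<longlongrightarrow> lam j) (net_filter \<Theta>1 le1)) \<and>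
    convolution_tendsto M (\<lambda>\<eta>. F (\<phi> \<eta>)) f x (\<Sum>j=1..k. lam j * L j) (net_filter \<Theta>1 le1) \<and>
    ((\<forall>N. open N \<and> 0 \<in> N \<longrightarrow>
        ((\<lambda>\<eta>. SUP y\<in>-N. ennreal (norm (F (\<phi> \<eta>) y))) \<longlongrightarrow> 0) (net_filter \<Theta>1 le1)) \<longrightarrow>
     (\<forall>g z K. L_one_admissible M g \<or> L_infinity M g \<longrightarrow>
        (\<forall>j\<in>{1..k}. limit_along g z (A j) (K j)) \<longrightarrow>
        convolution_tendsto M (\<lambda>\<eta>. F (\<phi> \<eta>)) g z (\<Sum>j=1..k. lam j * K j) (net_filter \<Theta>1 le1)))"
proof -
  note lc = assms(1) and haar = assms(2) and part = assms(4)
  note sets = sets_haar[OF haar]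
  have D: "directed_set \<Theta> le" and Fint: "\<And>\<theta>. \<theta> \<in> \<Theta> \<Longrightarrow> integrable M (F \<theta>)"
    and Ftail: "\<And>N. open N \<Longrightarrow> 0 \<in> N \<Longrightarrow>
      ((\<lambda>\<theta>. LINT y:-N|M. norm (F \<theta> y)) \<longlongrightarrow> 0) (net_filter \<Theta> le)"
    using assms(3) by (simp_all add: approximate_identity_def)
  have "\<exists>C. \<forall>\<theta>\<in>\<Theta>. (LINT y|M. norm (F \<theta> y)) \<le> C"
    using assms(3) by (simp add: approximate_identity_def)
  then obtain C where C: "\<And>\<theta>. \<theta> \<in> \<Theta> \<Longrightarrow> (LINT y|M. norm (F \<theta> y)) \<le> C"
    by blast
  have bd: "norm (LINT y:A j|M. F \<theta> y) \<le> C" if "j \<in> {1..k}" "\<theta> \<in> \<Theta>" for j \<theta>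
  proof -
    have "A j \<in> sets M" using part that(1) by (simp add: local_partition_def sets)
    then show ?thesis using norm_set_integral_le[OF Fint[OF that(2)]] C[OF that(2)]
      by (meson order.trans)
  qed
  obtain \<Theta>1 :: "('i \<times> nat) set" and le1 \<phi> lam where sub: "subnet \<Theta> le \<Theta>1 le1 \<phi>"
    and lam: "\<And>j. j \<in> {1..k} \<Longrightarrow> ((\<lambda>\<eta>. LINT y:A j|M. F (\<phi> \<eta>) y) \<longlongrightarrow> lam j) (net_filter \<Theta>1 le1)"
    by (rule ex_subnet_convergent[OF D, of "{1..k}" "\<lambda>j \<theta>. LINT y:A j|M. F \<theta> y" C])
      (simp, rule bd, assumption+, rule that)
  let ?\<F> = "net_filter \<Theta>1 le1"
  note fl = filterlim_subnet[OF D sub]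
  have "\<forall>\<^sub>F \<theta> in net_filter \<Theta> le. integrable M (F \<theta>) \<and> (LINT y|M. norm (F \<theta> y)) \<le> C"
    unfolding eventually_net_filter[OF D] using Fint C directed_setD(1)[OF D] by blast
  then have FC: "\<forall>\<^sub>F \<eta> in ?\<F>. integrable M (F (\<phi> \<eta>)) \<and> (LINT y|M. norm (F (\<phi> \<eta>) y)) \<le> C"
    using fl unfolding filterlim_iff by blast
  have tail: "((\<lambda>\<eta>. LINT y:-N|M. norm (F (\<phi> \<eta>) y)) \<longlongrightarrow> 0) ?\<F>" if "open N" "0 \<in> N" for N
    using Ftail[OF that] fl by (rule filterlim_compose)
  note main = convolution_tendsto_of_tails[OF haar part, where F = "\<lambda>\<eta>. F (\<phi> \<eta>)" and \<F> = ?\<F>,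
    OF FC tail]
  have closed: "- N \<in> sets borel" if "open N" for N :: "'g set"
    using that by (intro borel_closed closed_Compl)
  \<comment> \<open>Serves both for \<open>f\<close> at \<open>x\<close> and for the
    \<open>L_infinity\<close> alternative of the second assertion.\<close>
  have bounded_case: "convolution_tendsto M (\<lambda>\<eta>. F (\<phi> \<eta>)) g z (\<Sum>j=1..k. lam j * K j) ?\<F>"
    if g: "L_infinity M g" and lim: "\<forall>j\<in>{1..k}. limit_along g z (A j) (K j)" for g z K
  proof -
    obtain B where gm: "g \<in> borel_measurable M" and B: "AE y in M. norm (g y) \<le> B"
      using g unfolding L_infinity_def by blast
    note L = set_integral_reflected_mult_bounded[OF haar lc gm B]
    show ?thesis
    proof (rule main[OF _ _ _ gm lim])
      fix N :: "'g set" assume N: "open N" "0 \<in> N"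
      show "\<forall>\<^sub>F \<eta> in ?\<F>. set_integrable M (-N) (\<lambda>y. F (\<phi> \<eta>) y * g (- y + z))"
        using FC by eventually_elim (use L(1)[OF _ closed[OF N(1)]] in blast)
      have "\<forall>\<^sub>F \<eta> in ?\<F>. norm (LINT y:-N|M. norm (F (\<phi> \<eta>) y * g (- y + z)))
          \<le> \<bar>B\<bar> * (LINT y:-N|M. norm (F (\<phi> \<eta>) y))"
        using FC
      proof eventually_elim
        case (elim \<eta>)
        have "0 \<le> (LINT y:-N|M. norm (F (\<phi> \<eta>) y * g (- y + z)))"
          unfolding set_lebesgue_integral_def by (intro integral_nonneg_AE) simp
        then show ?case using L(2)[OF conjunct1[OF elim] closed[OF N(1)]] by simp
      qed
      then show "((\<lambda>\<eta>. LINT y:-N|M. norm (F (\<phi> \<eta>) y * g (- y + z))) \<longlongrightarrow> 0) ?\<F>"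
        by (rule Lim_null_comparison) (use tendsto_mult_left[OF tail[OF N], of "\<bar>B\<bar>"] in simp)
    qed (use lam in auto)
  qed
  have integrable_case: "convolution_tendsto M (\<lambda>\<eta>. F (\<phi> \<eta>)) g z (\<Sum>j=1..k. lam j * K j) ?\<F>"
    if sup: "\<forall>N. open N \<and> 0 \<in> N \<longrightarrow> ((\<lambda>\<eta>. SUP y\<in>-N. ennreal (norm (F (\<phi> \<eta>) y))) \<longlongrightarrow> 0) ?\<F>"
      and g: "L_one_admissible M g" and lim: "\<forall>j\<in>{1..k}. limit_along g z (A j) (K j)" for g z K
  proof -
    have gi: "integrable M g" using g by (simp add: L_one_admissible_def)
    have "integrable M (\<lambda>y. g (- y))"
      using g unimodular_integrable_uminus[OF haar lc _ gi] unfolding L_one_admissible_def by blast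
    \<comment> \<open>After reflection, only a left translation by \<open>- z\<close> remains, since
      \<open>- (- z + y) = - y + z\<close>.\<close>
    then have "integrable M (\<lambda>y. g (- (- z + y)))"
      by (rule integrable_haar_translate[OF haar])
    then have h: "integrable M (\<lambda>y. g (- y + z))" by (simp add: minus_add)
    let ?I = "LINT y|M. norm (g (- y + z))"
    have I0: "?I \<ge> 0" by simp
    have small: "\<forall>\<^sub>F \<eta> in ?\<F>. set_integrable M (-N) (\<lambda>y. F (\<phi> \<eta>) y * g (- y + z)) \<and>
        (LINT y:-N|M. norm (F (\<phi> \<eta>) y * g (- y + z))) \<le> e * ?I"
      if N: "open N" "0 \<in> N" and e: "e > 0" for N and e :: real
    proof -
      have "\<forall>\<^sub>F \<eta> in ?\<F>. (SUP y\<in>-N. ennreal (norm (F (\<phi> \<eta>) y))) < ennreal e"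
        using sup N e by (intro order_tendstoD(2)[of _ 0]) auto
      with FC show ?thesis
      proof eventually_elim
        case (elim \<eta>)
        have "- N \<in> sets M" using closed[OF N(1)] by (simp add: sets)
        moreover have "F (\<phi> \<eta>) \<in> borel_measurable M" using elim(1) by auto
        ultimately show ?case
          using set_integral_mult_bounded[OF _ _ h less_imp_le[OF e] less_imp_le[OF elim(2)]] by blast
      qed
    qed
    show ?thesis
    proof (rule main[OF _ _ _ _ lim])
      show "g \<in> borel_measurable M" using gi by simp
      fix N :: "'g set" assume N: "open N" "0 \<in> N"
      show "\<forall>\<^sub>F \<eta> in ?\<F>. set_integrable M (-N) (\<lambda>y. F (\<phi> \<eta>) y * g (- y + z))"
        using small[OF N zero_less_one] by eventually_elim blast
      show "((\<lambda>\<eta>. LINT y:-N|M. norm (F (\<phi> \<eta>) y * g (- y + z))) \<longlongrightarrow> 0) ?\<F>"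
      proof (rule tendstoI)
        fix \<epsilon> :: real assume \<epsilon>: "\<epsilon> > 0"
        \<comment> \<open>Adding \<open>1\<close> covers a vanishing \<open>?I\<close> and makes the
          final inequality strict.\<close>
        then have e: "\<epsilon> / (?I + 1) > 0" using I0 by (intro divide_pos_pos) linarith+
        have I1: "?I + 1 \<noteq> 0" using I0 by linarith
        have "\<epsilon> / (?I + 1) * ?I < \<epsilon> / (?I + 1) * (?I + 1)"
          using e by (intro mult_strict_left_mono) auto
        also have "\<dots> = \<epsilon>" using I1 by (rule nonzero_divide_eq_eq[THEN iffD1, OF _ refl, symmetric])
        finally have lt: "\<epsilon> / (?I + 1) * ?I < \<epsilon>" .
        show "\<forall>\<^sub>F \<eta> in ?\<F>. dist (LINT y:-N|M. norm (F (\<phi> \<eta>) y * g (- y + z))) 0 < \<epsilon>"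
        proof (rule eventually_mono[OF small[OF N e]])
          fix \<eta> assume *: "set_integrable M (-N) (\<lambda>y. F (\<phi> \<eta>) y * g (- y + z)) \<and>
            (LINT y:-N|M. norm (F (\<phi> \<eta>) y * g (- y + z))) \<le> \<epsilon> / (?I + 1) * ?I"
          have "0 \<le> (LINT y:-N|M. norm (F (\<phi> \<eta>) y * g (- y + z)))"
            unfolding set_lebesgue_integral_def by (intro integral_nonneg_AE) simp
          then show "dist (LINT y:-N|M. norm (F (\<phi> \<eta>) y * g (- y + z))) 0 < \<epsilon>"
            using * lt by (simp only: dist_real_def) linarith
        qed
      qed
    qed (use lam in auto)
  qed
  show ?thesis
  proof (intro exI[of _ \<Theta>1] exI[of _ le1] exI[of _ \<phi>] exI[of _ lam] conjI ballI impI allI)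
    show "convolution_tendsto M (\<lambda>\<eta>. F (\<phi> \<eta>)) f x (\<Sum>j=1..k. lam j * L j) ?\<F>"
      by (rule bounded_case[OF assms(5,6)])
    fix g z K
    assume sup: "\<forall>N. open N \<and> 0 \<in> N \<longrightarrow> ((\<lambda>\<eta>. SUP y\<in>-N. ennreal (norm (F (\<phi> \<eta>) y))) \<longlongrightarrow> 0) ?\<F>"
      and adm: "L_one_admissible M g \<or> L_infinity M g"
      and lim: "\<forall>j\<in>{1..k}. limit_along g z (A j) (K j)"
    from adm show "convolution_tendsto M (\<lambda>\<eta>. F (\<phi> \<eta>)) g z (\<Sum>j=1..k. lam j * K j) ?\<F>"
      using integrable_case[OF sup _ lim] bounded_case[OF _ lim] by (rule disjE)
  qed (rule sub, rule lam)
qed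

end
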